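(* If $\mathcal{R}$ is a randomized (label-less) protocol for information gathering on trees, then the expected running time of $\mathcal{R}$ on $n$-node trees (in the worst case over trees) is $\Omega(n\ln n)$. More specifically, let $c<\frac{1}{\ln^2 2}$ be a constant. If $\mathcal{R}$ is run on the star graph with a root and $n$ leaves for $T\le c\,n\ln n$ steps, then almost surely (i.e. with probability $1-o(1)$ as $n\to\infty$) there is at least one leaf whose rumor fails to reach the root.
   Context: Model. The network is a rooted tree with all edges directed from child to parent. Each node holds a rumor, and all rumors must be delivered to the root. Time is discrete. If a node transmits at step $t$, its parent receives the message if and only if the parent is not itself transmitting at step $t$ and no other child of the parent transmits at step $t$ (no collision detection, no feedback). Nodes have no labels: all nodes execute the same randomized protocol with independent randomness, and the behaviour of a node depends only on the time, its own random choices and the messages it has received. The protocol may be tailored to $n$ (and the lower bound is claimed even if the topology of the tree is known in advance). Star graph: a root together with $n$ children, all of which are leaves. Leaves never receive any information, so a label-less protocol running for $T$ steps on the star is equivalent to a probability distribution over subsets of $\{0,1,\dots,T-1\}$: each leaf $v$ independently picks a set $S_v$ from this common distribution and transmits exactly at the times in $S_v$. The rumor of leaf $v$ reaches the root if and only if there is a time $t\in S_v$ such that $t\notin S_w$ for all leaves $w\ne v$. *)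

theory Defs
  imports "HOL-Probability.Probability" "HOL-Library.FSet"
begin

text \<open>The value of \<open>parent\<close> at the root is irrelevant.\<close>

record network =
  nodes :: "nat set"
  root :: nat
  parent :: "nat \<Rightarrow> nat"

definition rooted_tree :: "network \<Rightarrow> bool" where
  "rooted_tree N \<longleftrightarrow>
     finite (nodes N) \<and> root N \<in> nodes N \<and>
     (\<forall>v \<in> nodes N - {root N}. parent N v \<in> nodes N) \<and>
     (\<forall>v \<in> nodes N. \<exists>k. (parent N ^^ k) v = root N)"

definition children :: "network \<Rightarrow> nat \<Rightarrow> nat set" where
  "children N v = {w \<in> nodes N - {root N}. parent N w = v}"

definition star :: "nat \<Rightarrow> network" where
  "star n = \<lparr>nodes = {0..n}, root = 0, parent = (\<lambda>_. 0)\<rparr>"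

text \<open>
  A message is a pair of control information and a finite set of rumors; its size is not bounded.
  The rumor of node \<open>v\<close> is represented by \<open>v\<close>. A node may read the rumors it receives, as part of
  its messages, but cannot use its own rumor as a label.

  A history lists, for the steps \<open>0, 1, \<dots>\<close> in turn, what a node has received; its length is the
  current time. \<open>None\<close> does not tell silence from collision.
\<close>

type_synonym 'c message = "'c \<times> nat fset"

type_synonym 'c history = "'c message option list"

text \<open>
  The random choices of a node are a single sample from \<open>seed\<close>. The action is a function of these
  choices and the history only: neither the name (hence the rumor) of the node nor its position is an
  argument. \<open>None\<close> means to listen; \<open>Some (c, own, F)\<close> means to transmit control information \<open>c\<close>,
  the node's own rumor if \<open>own\<close> holds, and those rumors in \<open>F\<close> that the node has received.
\<close>

record ('s, 'c) protocol =
  seed :: "'s measure"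
  action :: "'s \<Rightarrow> 'c history \<Rightarrow> ('c \<times> bool \<times> nat fset) option"

definition is_protocol :: "('s, 'c :: countable) protocol \<Rightarrow> bool" where
  "is_protocol P \<longleftrightarrow>
     prob_space (seed P) \<and>
     (\<forall>h. (\<lambda>s. action P s h) \<in> measurable (seed P) (count_space UNIV))"

primrec received_rumors :: "'c history \<Rightarrow> nat fset" where
  "received_rumors [] = {||}"
| "received_rumors (m # h) =
     (case m of None \<Rightarrow> {||} | Some (c, A) \<Rightarrow> A) |\<union>| received_rumors h"

text \<open>
  What \<open>v\<close> transmits when it has random choices \<open>s\<close> and history \<open>h\<close>. The root has no parent to
  transmit to, so it always listens; otherwise its own transmissions could only block reception.
\<close>

definition transmission ::
    "network \<Rightarrow> ('s, 'c) protocol \<Rightarrow> nat \<Rightarrow> 's \<Rightarrow> 'c history \<Rightarrow> 'c message option" where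
  "transmission N P v s h =
     (if v = root N then None
      else map_option
        (\<lambda>(c, own, F). (c, (if own then {|v|} else {||}) |\<union>| (F |\<inter>| received_rumors h)))
        (action P s h))"

text \<open>What \<open>v\<close> receives in a step in which each node \<open>w\<close> transmits \<open>X w\<close>.\<close>

definition reception :: "network \<Rightarrow> (nat \<Rightarrow> 'c message option) \<Rightarrow> nat \<Rightarrow> 'c message option" where
  "reception N X v =
     (if X v = None \<and> (\<exists>!w. w \<in> children N v \<and> X w \<noteq> None)
      then X (THE w. w \<in> children N v \<and> X w \<noteq> None)
      else None)"

text \<open>History of each node after \<open>t\<close> steps, where \<open>\<omega> v\<close> are the random choices of \<open>v\<close>.\<close>

primrec history ::
    "network \<Rightarrow> ('s, 'c) protocol \<Rightarrow> (nat \<Rightarrow> 's) \<Rightarrow> nat \<Rightarrow> nat \<Rightarrow> 'c history" where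
  "history N P \<omega> 0 = (\<lambda>v. [])"
| "history N P \<omega> (Suc t) =
     (\<lambda>v. history N P \<omega> t v @
        [reception N (\<lambda>w. transmission N P w (\<omega> w) (history N P \<omega> t w)) v])"

definition delivered ::
    "network \<Rightarrow> ('s, 'c) protocol \<Rightarrow> (nat \<Rightarrow> 's) \<Rightarrow> nat \<Rightarrow> nat \<Rightarrow> bool" where
  "delivered N P \<omega> t v \<longleftrightarrow>
     v = root N \<or> v |\<in>| received_rumors (history N P \<omega> t (root N))"

definition runs :: "network \<Rightarrow> ('s, 'c) protocol \<Rightarrow> (nat \<Rightarrow> 's) measure" where
  "runs N P = PiM (nodes N) (\<lambda>_. seed P)"

text \<open>The infimum of the empty set is \<open>\<infinity>\<close>, the running time if gathering never completes.\<close>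

definition running_time :: "network \<Rightarrow> ('s, 'c) protocol \<Rightarrow> (nat \<Rightarrow> 's) \<Rightarrow> ennreal" where
  "running_time N P \<omega> = (INF t \<in> {t. \<forall>v \<in> nodes N. delivered N P \<omega> t v}. of_nat t)"

definition expected_running_time :: "network \<Rightarrow> ('s, 'c) protocol \<Rightarrow> ennreal" where
  "expected_running_time N P = (\<integral>\<^sup>+ \<omega>. running_time N P \<omega> \<partial>runs N P)"

text \<open>
  The protocol may be tailored to the tree it is run on, in particular to its number of nodes.
\<close>

definition worst_case_expected_time :: "(network \<Rightarrow> ('s, 'c) protocol) \<Rightarrow> nat \<Rightarrow> ennreal" where
  "worst_case_expected_time R n =
     (SUP N \<in> {N. rooted_tree N \<and> card (nodes N) = n}. expected_running_time N (R N))"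

text \<open>
  On the star, a leaf never receives anything, so its behaviour up to time \<open>t\<close> amounts to a random set
  of transmission times, with the usual condition for delivery.
\<close>

lemma rooted_tree_star: "rooted_tree (star n)"
  unfolding rooted_tree_def star_def by (auto intro: exI[of _ 1])

lemma children_star: "children (star n) v = (if v = 0 then {1..n} else {})"
  by (auto simp: children_def star_def)

lemma received_rumors_append: "received_rumors (h @ h') = received_rumors h |\<union>| received_rumors h'"
  by (induction h) (auto split: option.splits)

lemma received_rumors_replicate_None: "received_rumors (replicate t None) = {||}"
  by (induction t) auto

lemma history_star_leaf:
  assumes "v \<noteq> 0"
  shows "history (star n) P \<omega> t v = replicate t None"
  using assms
  by (induction t) (auto simp: reception_def children_star replicate_append_same)

lemma delivered_star_iff:
  assumes v: "v \<in> {1..n}"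
  shows "delivered (star n) P \<omega> T v \<longleftrightarrow>
    (\<exists>t<T. (\<exists>c F. action P (\<omega> v) (replicate t None) = Some (c, True, F)) \<and>
           (\<forall>w \<in> {1..n} - {v}. action P (\<omega> w) (replicate t None) = None))"
    (is "_ \<longleftrightarrow> (\<exists>t<T. ?Q t)")
proof -
  have root: "root (star n) = 0"
    by (simp add: star_def)
  define X where
    "X t w = transmission (star n) P w (\<omega> w) (history (star n) P \<omega> t w)" for t w
  have X0: "X t 0 = None" for t
    by (simp add: X_def transmission_def root)
  have X: "X t w = map_option (\<lambda>(c, own, F). (c, if own then {|w|} else {||}))
      (action P (\<omega> w) (replicate t None))" if "w \<noteq> 0" for t w
    using that
    by (auto simp: X_def transmission_def root history_star_leaf received_rumors_replicate_None
        split: option.splits intro!: arg_cong[where f = "\<lambda>f. map_option f _"] ext)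
  have step: "v |\<in>| received_rumors [reception (star n) (X t) 0] \<longleftrightarrow> ?Q t" (is "?L \<longleftrightarrow> _") for t
  proof
    assume ?L
    then have ex: "\<exists>!w. w \<in> {1..n} \<and> X t w \<noteq> None"
      by (auto simp: reception_def children_star X0 split: if_splits)
    then obtain w where w: "w \<in> {1..n}" "X t w \<noteq> None"
      and uniq: "\<And>u. u \<in> {1..n} \<Longrightarrow> X t u \<noteq> None \<Longrightarrow> u = w"
      by blast
    have "(THE w. w \<in> {1..n} \<and> X t w \<noteq> None) = w"
      using w uniq by (intro the_equality) blast+
    then have "reception (star n) (X t) 0 = X t w"
      using ex by (simp add: reception_def children_star X0)
    with \<open>?L\<close> w have "w = v" and own: "\<exists>c F. action P (\<omega> w) (replicate t None) = Some (c, True, F)"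
      by (auto simp: X split: option.splits if_splits)
    moreover have "action P (\<omega> u) (replicate t None) = None" if "u \<in> {1..n} - {v}" for u
      using uniq[of u] that \<open>w = v\<close>
      by (cases "action P (\<omega> u) (replicate t None)") (auto simp: X)
    ultimately show "?Q t"
      by blast
  next
    assume Q: "?Q t"
    have Xv: "\<exists>c. X t v = Some (c, {|v|})"
      using Q v by (auto simp: X)
    have others: "X t w = None" if "w \<in> {1..n}" "w \<noteq> v" for w
      using Q that by (auto simp: X)
    have "\<exists>!w. w \<in> {1..n} \<and> X t w \<noteq> None"
      using Xv others v by (metis option.distinct(1))
    moreover have "(THE w. w \<in> {1..n} \<and> X t w \<noteq> None) = v"
      using Xv others v by (intro the_equality) (metis option.distinct(1))+
    ultimately have "reception (star n) (X t) 0 = X t v"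
      by (simp add: reception_def children_star X0)
    with Xv show ?L
      by auto
  qed
  have "v |\<in>| received_rumors (history (star n) P \<omega> T 0) \<longleftrightarrow> (\<exists>t<T. ?Q t)"
  proof (induction T)
    case (Suc T)
    have "history (star n) P \<omega> (Suc T) 0 =
        history (star n) P \<omega> T 0 @ [reception (star n) (X T) 0]"
      by (simp add: X_def[abs_def])
    then show ?case
      using Suc step[of T] by (simp only: received_rumors_append less_Suc_eq funion_iff) blast
  qed simp
  then show ?thesis
    using v by (simp add: delivered_def root)
qed

end

theory Submission
  imports Defs "HOL-Real_Asymp.Real_Asymp"
begin

text \<open>
  On the star, leaf \<open>v\<close> picks a random set \<open>S\<^sub>v\<close> of transmission times and fails if \<open>S\<^sub>v\<close> is covered by the
  sets of the other leaves. Let \<open>p\<^sub>t\<close> be the probability of \<open>t \<in> S\<^sub>v\<close>. If the number of leaves were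
  Poisson with mean \<open>\<lambda> \<approx> n\<close>, the events that \<open>t\<close> is covered would be positively correlated, so that a
  set \<open>S\<close> would be covered with probability at least \<open>\<Prod>t\<in>S. 1 - exp (- \<lambda> p\<^sub>t)\<close>; replacing Poisson by a
  fixed number costs an exponentially small error. The logarithm of this product has mean at least
  \<open>- (T / \<lambda>) (ln 2)\<^sup>2\<close>, because \<open>- x ln (1 - exp (- x)) \<le> (ln 2)\<^sup>2\<close>. So by Markov's inequality a
  positive fraction of all sets is covered with probability at least \<open>n\<close> to the power \<open>\<epsilon> - 1\<close>.

  For concentration, split the leaves into a large covering group and a small testing group. Times
  with \<open>p\<^sub>t > 6 ln n / n\<close> are all covered with high probability. With the other times, truncated to sets
  of size at most \<open>n\<close> to a small power, two sets are covered almost independently: disjoint witnesses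
  contribute at most the product of the probabilities, and a common witness is unlikely. By
  Chebyshev's inequality the covering group leaves, with high probability, a chance of at least
  \<open>n\<close> to the power \<open>\<epsilon> - 1\<close>, up to a constant, for each testing leaf to be covered, and the testing
  leaves are independent.
\<close>

subsection \<open>Expectations over finitely supported distributions\<close>

text \<open>The distributions below have finite support. Expectations are then finite sums, so
  integrability is automatic and the order of two expectations may be exchanged.\<close>

abbreviation E :: "'a pmf \<Rightarrow> ('a \<Rightarrow> real) \<Rightarrow> real" where
  "E p f \<equiv> measure_pmf.expectation p f"

lemma E_mono:
  assumes "finite (set_pmf p)" "\<And>x. x \<in> set_pmf p \<Longrightarrow> f x \<le> g x"
  shows "E p f \<le> E p g"
  using assms by (intro integral_mono_AE integrable_measure_pmf_finite) (auto simp: AE_measure_pmf_iff)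

lemma E_cong:
  assumes "\<And>x. x \<in> set_pmf p \<Longrightarrow> f x = g x"
  shows "E p f = E p g"
  using assms by (intro integral_cong_AE) (auto simp: AE_measure_pmf_iff)

lemma E_add: "finite (set_pmf p) \<Longrightarrow> E p (\<lambda>x. f x + g x) = E p f + E p g"
  by (simp add: integrable_measure_pmf_finite)

lemma E_diff: "finite (set_pmf p) \<Longrightarrow> E p (\<lambda>x. f x - g x) = E p f - E p g"
  by (simp add: integrable_measure_pmf_finite)

lemma E_sum: "finite (set_pmf p) \<Longrightarrow> E p (\<lambda>x. \<Sum>i\<in>I. f i x) = (\<Sum>i\<in>I. E p (f i))"
  by (simp add: integrable_measure_pmf_finite)

lemma E_const: "E p (\<lambda>_. c) = c"
  by simp

lemma E_nonneg: "(\<And>x. x \<in> set_pmf p \<Longrightarrow> 0 \<le> f x) \<Longrightarrow> 0 \<le> E p f"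
  by (intro integral_nonneg_AE) (auto simp: AE_measure_pmf_iff)

lemma E_le:
  assumes "finite (set_pmf p)" "\<And>x. x \<in> set_pmf p \<Longrightarrow> f x \<le> c"
  shows "E p f \<le> c"
  using E_mono[OF assms] by simp

lemma E_finite: "finite (set_pmf p) \<Longrightarrow> E p f = (\<Sum>x\<in>set_pmf p. pmf p x * f x)"
  by (subst integral_measure_pmf_real[of "set_pmf p"]) (auto simp: mult.commute)

lemma E_swap:
  assumes "finite (set_pmf p)" "finite (set_pmf q)"
  shows "E p (\<lambda>x. E q (f x)) = E q (\<lambda>y. E p (\<lambda>x. f x y))"
  by (simp add: E_finite assms sum_distrib_left mult.left_commute) (rule sum.swap)

lemma E_Markov:
  assumes "finite (set_pmf p)" "\<And>x. x \<in> set_pmf p \<Longrightarrow> 0 \<le> f x" "0 < c"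
  shows "E p (\<lambda>x. of_bool (c \<le> f x)) \<le> E p f / c"
proof -
  have "E p (\<lambda>x. of_bool (c \<le> f x)) \<le> E p (\<lambda>x. f x / c)"
    using assms by (intro E_mono) (auto simp: field_simps)
  then show ?thesis by simp
qed

lemma finite_replicate_pmf:
  assumes "finite (set_pmf p)"
  shows "finite (set_pmf (replicate_pmf m p))"
  using finite_lists_length_eq[OF assms, of m]
  by (simp add: set_replicate_pmf lists_eq_set)

lemma E_bind:
  assumes "finite (set_pmf p)" "\<And>x. x \<in> set_pmf p \<Longrightarrow> finite (set_pmf (f x))"
  shows "E (bind_pmf p f) h = E p (\<lambda>x. E (f x) h)"
  by (subst pmf_expectation_bind[of "set_pmf p"]) (use assms in \<open>auto simp: E_finite\<close>)

lemma E_replicate_Suc: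
  assumes "finite (set_pmf p)"
  shows "E (replicate_pmf (Suc m) p) f = E p (\<lambda>x. E (replicate_pmf m p) (\<lambda>xs. f (x # xs)))"
  by (simp add: E_bind assms finite_replicate_pmf)

lemma E_replicate_add:
  assumes "finite (set_pmf p)"
  shows "E (replicate_pmf (m + r) p) f =
    E (replicate_pmf m p) (\<lambda>xs. E (replicate_pmf r p) (\<lambda>ys. f (xs @ ys)))"
  by (simp add: replicate_pmf_distrib E_bind assms finite_replicate_pmf)

lemma replicate_pmf_map: "replicate_pmf m (map_pmf f p) = map_pmf (map f) (replicate_pmf m p)"
  by (induction m) (simp_all add: map_bind_pmf bind_map_pmf)


subsection \<open>Covering a set by independent random sets\<close>

definition cover_prob :: "'a set pmf \<Rightarrow> nat \<Rightarrow> 'a set \<Rightarrow> real" where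
  "cover_prob q m S = E (replicate_pmf m q) (\<lambda>xs. of_bool (S \<subseteq> \<Union>(set xs)))"

text \<open>By \<open>cover_prob_insert\<close> this is exactly what \<open>cover_prob\<close> loses
  when \<open>t\<close> joins \<open>S\<close>. The product bound for Poisson families comes from
  estimating this loss.\<close>

definition cover_prob_avoiding :: "'a set pmf \<Rightarrow> 'a \<Rightarrow> nat \<Rightarrow> 'a set \<Rightarrow> real" where
  "cover_prob_avoiding q t m S = E (replicate_pmf m q) (\<lambda>xs. of_bool (S \<subseteq> \<Union>(set xs) \<and> t \<notin> \<Union>(set xs)))"

definition hit_prob :: "'a set pmf \<Rightarrow> 'a \<Rightarrow> real" where
  "hit_prob q t = E q (\<lambda>A. of_bool (t \<in> A))"

lemma cover_prob_0: "cover_prob q 0 S = of_bool (S = {})"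
  by (simp add: cover_prob_def)

lemma cover_prob_Suc: "finite (set_pmf q) \<Longrightarrow> cover_prob q (Suc m) S = E q (\<lambda>A. cover_prob q m (S - A))"
  by (simp add: cover_prob_def E_replicate_Suc Diff_subset_conv del: replicate_pmf.simps)

lemma cover_prob_avoiding_Suc:
  "finite (set_pmf q) \<Longrightarrow>
    cover_prob_avoiding q t (Suc m) S = E q (\<lambda>A. of_bool (t \<notin> A) * cover_prob_avoiding q t m (S - A))"
  by (simp add: cover_prob_avoiding_def E_replicate_Suc Diff_subset_conv of_bool_conj mult.left_commute
      flip: integral_mult_right_zero del: replicate_pmf.simps)

lemma cover_prob_nonneg: "0 \<le> cover_prob q m S"
  unfolding cover_prob_def by (rule E_nonneg) simp

lemma cover_prob_le_1: "finite (set_pmf q) \<Longrightarrow> cover_prob q m S \<le> 1"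
  unfolding cover_prob_def by (rule E_le) (auto simp: finite_replicate_pmf)

lemma cover_prob_avoiding_nonneg: "0 \<le> cover_prob_avoiding q t m S"
  unfolding cover_prob_avoiding_def by (rule E_nonneg) simp

lemma cover_prob_avoiding_le_1: "finite (set_pmf q) \<Longrightarrow> cover_prob_avoiding q t m S \<le> 1"
  unfolding cover_prob_avoiding_def by (rule E_le) (auto simp: finite_replicate_pmf)

lemma cover_prob_antimono: "finite (set_pmf q) \<Longrightarrow> S \<subseteq> S' \<Longrightarrow> cover_prob q m S' \<le> cover_prob q m S"
  unfolding cover_prob_def by (rule E_mono) (auto simp: finite_replicate_pmf)

lemma cover_prob_Suc_mono:
  assumes "finite (set_pmf q)"
  shows "cover_prob q m S \<le> cover_prob q (Suc m) S"
proof -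
  have "E q (\<lambda>A. cover_prob q m S) \<le> E q (\<lambda>A. cover_prob q m (S - A))"
    using assms by (intro E_mono cover_prob_antimono) auto
  then show ?thesis
    by (simp add: cover_prob_Suc assms)
qed

lemma cover_prob_mono: "finite (set_pmf q) \<Longrightarrow> k \<le> m \<Longrightarrow> cover_prob q k S \<le> cover_prob q m S"
  by (rule lift_Suc_mono_le[of "\<lambda>k. cover_prob q k S"]) (auto intro: cover_prob_Suc_mono)

lemma cover_prob_insert:
  assumes "finite (set_pmf q)"
  shows "cover_prob q m (insert t S) = cover_prob q m S - cover_prob_avoiding q t m S"
  unfolding cover_prob_def cover_prob_avoiding_def
  by (subst E_diff[symmetric]) (auto simp: finite_replicate_pmf assms intro!: E_cong)

lemma hit_prob_nonneg: "0 \<le> hit_prob q t"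
  unfolding hit_prob_def by (rule E_nonneg) simp

lemma hit_prob_le_1: "finite (set_pmf q) \<Longrightarrow> hit_prob q t \<le> 1"
  unfolding hit_prob_def by (rule E_le) auto

text \<open>
  Condition on which of the \<open>k\<close> sets contain \<open>t\<close>, and let only the other \<open>j\<close> sets cover \<open>S\<close>.
\<close>

lemma cover_prob_ge_binomial:
  assumes fin: "finite (set_pmf q)"
  shows "(\<Sum>j\<le>k. real (k choose j) * hit_prob q t ^ (k - j) * cover_prob_avoiding q t j S) \<le> cover_prob q k S"
proof (induction k arbitrary: S)
  case 0
  show ?case
    by (simp add: cover_prob_avoiding_def cover_prob_0)
next
  case (Suc k)
  let ?P = "hit_prob q t" and ?a = "\<lambda>j. cover_prob_avoiding q t j S"
  let ?b = "\<lambda>j. real (k choose j) * ?P ^ (k - j)"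
  \<comment> \<open>Pascal's rule splits the sum: the terms with \<open>?a (Suc j)\<close> belong to
    a first set that misses \<open>t\<close>, the extra factor \<open>?P\<close> to a first set that
    contains it.\<close>
  have "(\<Sum>j\<le>Suc k. real (Suc k choose j) * ?P ^ (Suc k - j) * ?a j)
      = ?P ^ Suc k * ?a 0 + (\<Sum>j\<le>k. (real (k choose j) + real (k choose Suc j)) * ?P ^ (k - j) * ?a (Suc j))"
    by (subst sum.atMost_Suc_shift) simp
  also have "\<dots> = (\<Sum>j\<le>k. ?b j * ?a (Suc j)) +
      (?P ^ Suc k * ?a 0 + (\<Sum>j\<le>k. real (k choose Suc j) * ?P ^ (k - j) * ?a (Suc j)))"
    by (simp add: algebra_simps sum.distrib)
  also have "?P ^ Suc k * ?a 0 + (\<Sum>j\<le>k. real (k choose Suc j) * ?P ^ (k - j) * ?a (Suc j))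
      = (\<Sum>j\<le>Suc k. real (k choose j) * ?P ^ (Suc k - j) * ?a j)"
    by (subst sum.atMost_Suc_shift) simp
  also have "\<dots> = (\<Sum>j\<le>k. ?P * (?b j * ?a j))"
    by (simp add: Suc_diff_le mult_ac)
  also have "\<dots> = ?P * (\<Sum>j\<le>k. ?b j * ?a j)"
    by (simp add: sum_distrib_left)
  finally have eq: "(\<Sum>j\<le>Suc k. real (Suc k choose j) * ?P ^ (Suc k - j) * ?a j) =
      (\<Sum>j\<le>k. ?b j * ?a (Suc j)) + ?P * (\<Sum>j\<le>k. ?b j * ?a j)" .
  have "(\<Sum>j\<le>k. ?b j * ?a (Suc j)) =
      E q (\<lambda>A. of_bool (t \<notin> A) * (\<Sum>j\<le>k. ?b j * cover_prob_avoiding q t j (S - A)))"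
    by (simp add: cover_prob_avoiding_Suc[OF fin] sum_distrib_left E_sum[OF fin] mult.left_commute
        flip: integral_mult_right_zero del: sum_mult_of_bool_eq sum_of_bool_mult_eq)
  also have "\<dots> \<le> E q (\<lambda>A. of_bool (t \<notin> A) * cover_prob q k (S - A))"
    using Suc.IH by (intro E_mono[OF fin] mult_left_mono) auto
  finally have 1: "(\<Sum>j\<le>k. ?b j * ?a (Suc j)) \<le> E q (\<lambda>A. of_bool (t \<notin> A) * cover_prob q k (S - A))" .
  have "?P * (\<Sum>j\<le>k. ?b j * ?a j) \<le> ?P * cover_prob q k S"
    by (intro mult_left_mono Suc.IH hit_prob_nonneg)
  also have "\<dots> = E q (\<lambda>A. of_bool (t \<in> A) * cover_prob q k S)"
    by (simp add: hit_prob_def)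
  \<comment> \<open>A first set that contains \<open>t\<close> may also cover part of
    \<open>S\<close>; this help is given away.\<close>
  also have "\<dots> \<le> E q (\<lambda>A. of_bool (t \<in> A) * cover_prob q k (S - A))"
    by (intro E_mono[OF fin] mult_left_mono cover_prob_antimono[OF fin]) auto
  finally have "(\<Sum>j\<le>k. ?b j * ?a (Suc j)) + ?P * (\<Sum>j\<le>k. ?b j * ?a j) \<le>
     E q (\<lambda>A. of_bool (t \<notin> A) * cover_prob q k (S - A) + of_bool (t \<in> A) * cover_prob q k (S - A))"
    using 1 by (subst E_add[OF fin]) simp
  also have "\<dots> = cover_prob q (Suc k) S"
    by (simp add: cover_prob_Suc fin) (intro E_cong, auto)
  finally show ?case
    using eq by simp
qed

section \<open>Covering by a Poisson number of sets\<close>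

text \<open>The normalising factor \<open>exp (- l)\<close> of the Poisson distribution is left out.\<close>

definition poisson_cover :: "'a set pmf \<Rightarrow> real \<Rightarrow> 'a set \<Rightarrow> real" where
  "poisson_cover q l S = (\<Sum>k. l ^ k / fact k * cover_prob q k S)"

lemma summable_exp_weighted:
  fixes l :: real
  assumes "\<And>k. 0 \<le> f k" "\<And>k. f k \<le> 1" "0 \<le> l"
  shows "summable (\<lambda>k. l ^ k / fact k * f k)"
proof (rule summable_comparison_test')
  show "summable (\<lambda>k. l ^ k / fact k)"
    using summable_exp[of l] by (simp add: field_simps)
  show "norm (l ^ k / fact k * f k) \<le> l ^ k / fact k" if "0 \<le> k" for k
    using assms mult_left_le[of "f k" "l ^ k / fact k"] by (simp add: abs_mult)
qed

text \<open>Thinning: in a Poisson family the sets that contain \<open>t\<close> are independent of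
  those that avoid it. Hence "\<open>S\<close> covered, \<open>t\<close> missed" has probability
  \<open>exp (- (l * hit_prob q t))\<close> times that of "\<open>S\<close> covered by the sets
  avoiding \<open>t\<close>", and the latter is at most the probability that \<open>S\<close> is
  covered.\<close>

lemma poisson_cover_insert:
  assumes fin: "finite (set_pmf q)" and l: "0 \<le> l"
  shows "(1 - exp (- (l * hit_prob q t))) * poisson_cover q l S \<le> poisson_cover q l (insert t S)"
proof -
  let ?A = "\<lambda>j. l ^ j / fact j * cover_prob_avoiding q t j S"
  let ?Q = "\<lambda>i. (l * hit_prob q t) ^ i / fact i"
  have sc: "summable (\<lambda>k. l ^ k / fact k * cover_prob q k S)" for S
    by (intro summable_exp_weighted cover_prob_nonneg cover_prob_le_1 fin l)
  have sa: "summable ?A"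
    by (intro summable_exp_weighted cover_prob_avoiding_nonneg cover_prob_avoiding_le_1 fin l)
  have sQ: "summable ?Q"
    using summable_exp[of "l * hit_prob q t"] by (simp add: field_simps)
  have eQ: "(\<Sum>i. ?Q i) = exp (l * hit_prob q t)"
    by (simp add: exp_def field_simps)
  have nA: "0 \<le> ?A j" for j
    using l by (intro mult_nonneg_nonneg cover_prob_avoiding_nonneg) auto
  have nQ: "0 \<le> ?Q j" for j
    using l by (intro divide_nonneg_nonneg zero_le_power mult_nonneg_nonneg hit_prob_nonneg) auto
  \<comment> \<open>Multiplying by the series of \<open>exp (l * hit_prob q t)\<close> restores the
    sets that contain \<open>t\<close>. The coefficients of the Cauchy product are the binomial sums
    of \<open>cover_prob_ge_binomial\<close>.\<close>
  have prod: "(\<lambda>k. \<Sum>i\<le>k. ?A i * ?Q (k - i)) sums ((\<Sum>j. ?A j) * (\<Sum>i. ?Q i))"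
    using sa sQ nA nQ by (intro Cauchy_product_sums) (simp_all only: real_norm_def abs_of_nonneg)
  have "(\<Sum>i\<le>k. ?A i * ?Q (k - i)) \<le> l ^ k / fact k * cover_prob q k S" for k
  proof -
    have "?A i * ?Q (k - i) =
        l ^ k / fact k * (real (k choose i) * hit_prob q t ^ (k - i) * cover_prob_avoiding q t i S)"
      if "i \<le> k" for i
      using that by (simp add: binomial_fact power_mult_distrib field_simps flip: power_add)
    then have "(\<Sum>i\<le>k. ?A i * ?Q (k - i)) =
        l ^ k / fact k * (\<Sum>i\<le>k. real (k choose i) * hit_prob q t ^ (k - i) * cover_prob_avoiding q t i S)"
      by (simp add: sum_distrib_left)
    also have "\<dots> \<le> l ^ k / fact k * cover_prob q k S"
      using l by (intro mult_left_mono cover_prob_ge_binomial fin) auto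
    finally show ?thesis .
  qed
  then have "(\<Sum>j. ?A j) * exp (l * hit_prob q t) \<le> poisson_cover q l S"
    unfolding poisson_cover_def using sums_le[OF _ prod summable_sums[OF sc]] eQ by simp
  then have "(\<Sum>j. ?A j) \<le> exp (- (l * hit_prob q t)) * poisson_cover q l S"
    by (simp add: exp_minus field_simps)
  moreover have "poisson_cover q l (insert t S) = poisson_cover q l S - (\<Sum>j. ?A j)"
    unfolding poisson_cover_def
    by (subst suminf_diff[OF sc sa]) (simp add: cover_prob_insert[OF fin] algebra_simps)
  ultimately show ?thesis
    by (simp add: algebra_simps)
qed

lemma poisson_cover_ge_prod:
  assumes fin: "finite (set_pmf q)" and l: "0 \<le> l" and "finite S"
  shows "exp l * (\<Prod>t\<in>S. 1 - exp (- (l * hit_prob q t))) \<le> poisson_cover q l S"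
  using \<open>finite S\<close>
proof induction
  case empty
  have "cover_prob q k {} = 1" for k
    by (simp add: cover_prob_def)
  then show ?case
    by (simp add: poisson_cover_def exp_def field_simps)
next
  case (insert t S)
  have "0 \<le> 1 - exp (- (l * hit_prob q t))"
    using l hit_prob_nonneg[of q t] by simp
  then have "(1 - exp (- (l * hit_prob q t))) * (exp l * (\<Prod>t\<in>S. 1 - exp (- (l * hit_prob q t))))
      \<le> (1 - exp (- (l * hit_prob q t))) * poisson_cover q l S"
    by (intro mult_left_mono insert.IH)
  also have "\<dots> \<le> poisson_cover q l (insert t S)"
    by (rule poisson_cover_insert[OF fin l])
  finally show ?case
    using insert by (simp add: mult_ac)
qed

text \<open>Chernoff's bound for the Poisson tail beyond \<open>m\<close>, with free parameter \<open>x\<close>.\<close>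

lemma poisson_cover_le:
  assumes fin: "finite (set_pmf q)" and l: "0 \<le> l" and x: "1 \<le> x"
  shows "poisson_cover q l S \<le> exp l * cover_prob q m S + exp (l * x) / x ^ m"
proof -
  have sc: "summable (\<lambda>k. l ^ k / fact k * cover_prob q k S)"
    by (intro summable_exp_weighted cover_prob_nonneg cover_prob_le_1 fin l)
  have e: "(\<lambda>k. y ^ k / fact k) sums exp y" for y :: real
    using exp_converges[of y] by (simp add: field_simps)
  have "poisson_cover q l S \<le> cover_prob q m S * exp l + exp (l * x) * (1 / x ^ m)"
    unfolding poisson_cover_def
  proof (rule sums_le[OF _ summable_sums[OF sc] sums_add[OF sums_mult[OF e] sums_mult2[OF e]]])
    fix k
    show "l ^ k / fact k * cover_prob q k S \<le> cover_prob q m S * (l ^ k / fact k) + (l * x) ^ k / fact k * (1 / x ^ m)"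
    proof (cases "k \<le> m")
      case True
      have "l ^ k / fact k * cover_prob q k S \<le> l ^ k / fact k * cover_prob q m S"
        using l by (intro mult_left_mono cover_prob_mono fin True) auto
      moreover have "0 \<le> (l * x) ^ k / fact k * (1 / x ^ m)"
        using l x by (intro mult_nonneg_nonneg divide_nonneg_nonneg zero_le_power) auto
      ultimately show ?thesis
        by (simp add: mult.commute)
    next
      case False
      have "l ^ k / fact k * cover_prob q k S \<le> l ^ k / fact k * 1"
        using l by (intro mult_left_mono cover_prob_le_1 fin) auto
      also have "\<dots> \<le> l ^ k / fact k * (x ^ k / x ^ m)"
        using l x False power_increasing[of m k x] by (intro mult_left_mono) (auto simp: field_simps)
      also have "\<dots> = (l * x) ^ k / fact k * (1 / x ^ m)"
        by (simp add: power_mult_distrib)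
      also have "\<dots> \<le> cover_prob q m S * (l ^ k / fact k) + \<dots>"
        using l by (simp add: cover_prob_nonneg)
      finally show ?thesis .
    qed
  qed
  then show ?thesis
    by (simp add: mult.commute)
qed

text \<open>Return to a fixed number \<open>m\<close> of sets. The Poisson mean is lowered to
  \<open>(1 - 2 * d) * m\<close> and the tail bound is used with \<open>x = 1 + d\<close>; since
  \<open>ln (1 + d)\<close> is at least \<open>d - d^2\<close>, the normalised tail is at most
  \<open>exp (- d^2 * m)\<close>.\<close>

lemma cover_prob_ge:
  assumes fin: "finite (set_pmf q)" and S: "finite S" and d: "0 < d" "d \<le> 1 / 2"
  shows "(\<Prod>t\<in>S. 1 - exp (- ((1 - 2 * d) * real m * hit_prob q t))) - exp (- (d\<^sup>2 * real m)) \<le> cover_prob q m S"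
proof -
  define l where "l = (1 - 2 * d) * real m"
  have l: "0 \<le> l"
    using d by (simp add: l_def)
  have "d - d\<^sup>2 \<le> ln (1 + d)"
    using ln_one_plus_pos_lower_bound[of d] d by simp
  from mult_left_mono[OF this, of "real m"] 
  have "l * d - real m * ln (1 + d) \<le> - (d\<^sup>2 * real m)"
    by (simp add: l_def algebra_simps power2_eq_square)
  moreover have "(1 + d) ^ m = exp (real m * ln (1 + d))"
    using d by (simp add: exp_of_nat_mult)
  then have "exp (l * (1 + d)) / (1 + d) ^ m = exp l * exp (l * d - real m * ln (1 + d))"
    by (simp add: exp_diff algebra_simps exp_add)
  ultimately have tail: "exp (l * (1 + d)) / (1 + d) ^ m \<le> exp l * exp (- (d\<^sup>2 * real m))"
    by simp
  have "exp l * (\<Prod>t\<in>S. 1 - exp (- (l * hit_prob q t))) \<le> exp l * cover_prob q m S + exp (l * (1 + d)) / (1 + d) ^ m"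
    using poisson_cover_ge_prod[OF fin l S] poisson_cover_le[OF fin l, of "1 + d" S m] d by linarith
  also have "\<dots> \<le> exp l * (cover_prob q m S + exp (- (d\<^sup>2 * real m)))"
    using tail by (simp add: distrib_left)
  finally show ?thesis
    by (simp add: l_def)
qed

subsection \<open>Concentration\<close>

text \<open>
  A form of the van den Berg--Kesten inequality. The sets \<open>X\<close> and \<open>Y\<close> stay fixed in the induction,
  whereas \<open>S\<close> and \<open>S'\<close> lose the elements that are already covered.
\<close>

lemma cover_prob_disjointly:
  assumes fin: "finite (set_pmf q)" and "S \<subseteq> X" "S' \<subseteq> Y"
  shows "E (replicate_pmf m q) (\<lambda>xs. of_bool (S \<subseteq> \<Union>(set xs) \<and> S' \<subseteq> \<Union>(set xs) \<and>
      (\<forall>A\<in>set xs. A \<inter> X = {} \<or> A \<inter> Y = {}))) \<le> cover_prob q m S * cover_prob q m S'"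
  using assms(2,3)
proof (induction m arbitrary: S S')
  case 0
  show ?case
    by (simp add: cover_prob_0)
next
  case (Suc m)
  let ?f = "cover_prob q m" and ?R = "replicate_pmf m q"
  let ?D = "\<lambda>xs. \<forall>A\<in>set xs. A \<inter> X = {} \<or> A \<inter> Y = {}"
  let ?Q = "\<lambda>S S' xs. S \<subseteq> \<Union>(set xs) \<and> S' \<subseteq> \<Union>(set xs) \<and> ?D xs"
  have gain: "?f S \<le> ?f (S - A)" for S A
    by (intro cover_prob_antimono fin) auto
  \<comment> \<open>A first set \<open>A\<close> that meets both \<open>X\<close> and
    \<open>Y\<close> is forbidden, so \<open>A\<close> can reduce only one of \<open>S\<close> and
    \<open>S'\<close>. Thus at most one of the two gains occurs, and the other, being nonnegative,
    may be added.\<close>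
  have pointwise: "E ?R (\<lambda>xs. of_bool (?Q S S' (A # xs))) \<le>
      ?f S * ?f S' + ?f S' * (?f (S - A) - ?f S) + ?f S * (?f (S' - A) - ?f S')" for A
  proof -
    have nn: "0 \<le> ?f S' * (?f (S - A) - ?f S)" "0 \<le> ?f S * (?f (S' - A) - ?f S')"
      using gain cover_prob_nonneg by (metis diff_ge_0_iff_ge mult_nonneg_nonneg)+
    consider "A \<inter> Y = {}" | "A \<inter> X = {}" | "A \<inter> X \<noteq> {}" "A \<inter> Y \<noteq> {}"
      by blast
    then show ?thesis
    proof cases
      case 1
      have "E ?R (\<lambda>xs. of_bool (?Q S S' (A # xs))) \<le> E ?R (\<lambda>xs. of_bool (?Q (S - A) S' xs))"
        using 1 Suc.prems(2) by (intro E_mono finite_replicate_pmf fin) auto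
      also have "\<dots> \<le> ?f (S - A) * ?f S'"
        using Suc.prems by (intro Suc.IH) auto
      finally show ?thesis
        using nn by (simp add: algebra_simps)
    next
      case 2
      have "E ?R (\<lambda>xs. of_bool (?Q S S' (A # xs))) \<le> E ?R (\<lambda>xs. of_bool (?Q S (S' - A) xs))"
        using 2 Suc.prems(1) by (intro E_mono finite_replicate_pmf fin) auto
      also have "\<dots> \<le> ?f S * ?f (S' - A)"
        using Suc.prems by (intro Suc.IH) auto
      finally show ?thesis
        using nn by (simp add: algebra_simps)
    next
      case 3
      then have "E ?R (\<lambda>xs. of_bool (?Q S S' (A # xs))) = 0"
        by simp
      then show ?thesis
        using nn cover_prob_nonneg[of q m S] cover_prob_nonneg[of q m S'] by simp
    qed
  qed
  define a where "a = E q (\<lambda>A. ?f (S - A)) - ?f S"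
  define b where "b = E q (\<lambda>A. ?f (S' - A)) - ?f S'"
  have "0 \<le> a" "0 \<le> b"
    using cover_prob_Suc_mono[OF fin, of m] by (simp_all add: a_def b_def cover_prob_Suc[OF fin])
  have "E (replicate_pmf (Suc m) q) (\<lambda>xs. of_bool (?Q S S' xs)) =
      E q (\<lambda>A. E ?R (\<lambda>xs. of_bool (?Q S S' (A # xs))))"
    by (rule E_replicate_Suc[OF fin])
  also have "\<dots> \<le> E q (\<lambda>A. ?f S * ?f S' + ?f S' * (?f (S - A) - ?f S) + ?f S * (?f (S' - A) - ?f S'))"
    by (intro E_mono fin pointwise)
  also have "\<dots> = ?f S * ?f S' + ?f S' * a + ?f S * b"
    by (simp add: E_add fin E_diff a_def b_def)
  \<comment> \<open>The two sides differ by \<open>a * b\<close>, the term for simultaneous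
    gains.\<close>
  also have "\<dots> \<le> (?f S + a) * (?f S' + b)"
    using \<open>0 \<le> a\<close> \<open>0 \<le> b\<close> by (simp add: algebra_simps)
  also have "\<dots> = cover_prob q (Suc m) S * cover_prob q (Suc m) S'"
    by (simp add: a_def b_def cover_prob_Suc[OF fin])
  finally show ?case .
qed

section \<open>Common witnesses and the second moment\<close>

lemma E_meets_le:
  assumes fin: "finite (set_pmf q)" and B: "finite B" "card B \<le> K"
    and h: "\<And>t. hit_prob q t \<le> \<tau>"
  shows "E q (\<lambda>A. of_bool (A \<inter> B \<noteq> {})) \<le> real K * \<tau>"
proof -
  have "E q (\<lambda>A. of_bool (A \<inter> B \<noteq> {})) \<le> E q (\<lambda>A. \<Sum>t\<in>B. of_bool (t \<in> A))"
  proof (rule E_mono[OF fin])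
    fix A
    show "of_bool (A \<inter> B \<noteq> {}) \<le> (\<Sum>t\<in>B. of_bool (t \<in> A) :: real)"
    proof (cases "A \<inter> B = {}")
      case False
      then obtain t where "t \<in> A" "t \<in> B" by blast
      then show ?thesis
        using member_le_sum[of t B "\<lambda>t. of_bool (t \<in> A) :: real"] B by simp
    qed (simp add: sum_nonneg)
  qed
  also have "\<dots> = (\<Sum>t\<in>B. hit_prob q t)"
    by (subst E_sum[OF fin]) (simp add: hit_prob_def)
  also have "\<dots> \<le> real (card B) * \<tau>"
    using sum_mono[of B "hit_prob q" "\<lambda>_. \<tau>"] h by simp
  also have "\<dots> \<le> real K * \<tau>"
    using B(2) order_trans[OF hit_prob_nonneg h] by (intro mult_right_mono) auto
  finally show ?thesis .
qed

abbreviation meets :: "'a set \<Rightarrow> 'a set list \<Rightarrow> nat" where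
  "meets B xs \<equiv> length (filter (\<lambda>A. A \<inter> B \<noteq> {}) xs)"

text \<open>The number of sets that meet \<open>B\<close> is binomial; this is its exponential
  moment with base 2, used to make large values of \<open>meets\<close> negligible.\<close>

lemma E_two_power_meets:
  assumes fin: "finite (set_pmf q)"
  shows "E (replicate_pmf m q) (\<lambda>xs. 2 ^ meets B xs) = (1 + E q (\<lambda>A. of_bool (A \<inter> B \<noteq> {}))) ^ m"
proof (induction m)
  case (Suc m)
  let ?e = "E (replicate_pmf m q) (\<lambda>xs. 2 ^ meets B xs)"
  have "E (replicate_pmf (Suc m) q) (\<lambda>xs. 2 ^ meets B xs) = E q (\<lambda>A. (1 + of_bool (A \<inter> B \<noteq> {})) * ?e)"
    by (subst E_replicate_Suc[OF fin]) (intro E_cong, auto)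
  also have "\<dots> = (1 + E q (\<lambda>A. of_bool (A \<inter> B \<noteq> {}))) * ?e"
    by (simp add: E_add fin)
  finally show ?case
    by (simp add: Suc.IH)
qed simp

text \<open>Up to the threshold \<open>M\<close> the count is replaced by \<open>M\<close>. Above it
  the count is at most \<open>m\<close>, and \<open>2 ^ meets B xs / 2 ^ M\<close> exceeds 1.
  Keeping the factor \<open>cover_prob q m B\<close> matters: it makes the main error in
  \<open>second_moment\<close> linear in the small quantity \<open>a\<close>.\<close>

lemma E_meets_covered_le:
  assumes fin: "finite (set_pmf q)" and B: "finite B" "card B \<le> K"
    and h: "\<And>t. hit_prob q t \<le> \<tau>"
  shows "E (replicate_pmf m q) (\<lambda>xs. of_bool (B \<subseteq> \<Union>(set xs)) * real (meets B xs))
    \<le> real M * cover_prob q m B + real m * exp (real m * (real K * \<tau>)) / 2 ^ M"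
proof -
  let ?R = "replicate_pmf m q"
  have finR: "finite (set_pmf ?R)"
    by (rule finite_replicate_pmf[OF fin])
  have "E ?R (\<lambda>xs. of_bool (B \<subseteq> \<Union>(set xs)) * real (meets B xs))
      \<le> E ?R (\<lambda>xs. real M * of_bool (B \<subseteq> \<Union>(set xs)) + real m / 2 ^ M * 2 ^ meets B xs)"
  proof (rule E_mono[OF finR])
    fix xs assume xs: "xs \<in> set_pmf ?R"
    show "of_bool (B \<subseteq> \<Union>(set xs)) * real (meets B xs) \<le>
        real M * of_bool (B \<subseteq> \<Union>(set xs)) + real m / 2 ^ M * 2 ^ meets B xs"
    proof (cases "meets B xs \<le> M")
      case False
      have "real (meets B xs) \<le> real m"
        using xs length_filter_le[of _ xs] by (auto simp: set_replicate_pmf)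
      also have "\<dots> \<le> real m * (2 ^ meets B xs / 2 ^ M)"
        using False mult_left_mono[of 1 "2 ^ meets B xs / 2 ^ M :: real" "real m"] by simp
      finally show ?thesis
        by auto
    qed (auto intro: add_increasing2)
  qed
  also have "\<dots> = real M * cover_prob q m B + real m / 2 ^ M * (1 + E q (\<lambda>A. of_bool (A \<inter> B \<noteq> {}))) ^ m"
    by (subst E_add[OF finR]) (simp add: cover_prob_def E_two_power_meets[OF fin])
  also have "(1 + E q (\<lambda>A. of_bool (A \<inter> B \<noteq> {}))) ^ m \<le> exp (real K * \<tau>) ^ m"
  proof (intro power_mono)
    show "1 + E q (\<lambda>A. of_bool (A \<inter> B \<noteq> {})) \<le> exp (real K * \<tau>)"
      using E_meets_le[OF fin B h] exp_ge_add_one_self[of "real K * \<tau>"] by linarith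
    show "0 \<le> 1 + E q (\<lambda>A. of_bool (A \<inter> B \<noteq> {}))"
      using E_nonneg[of q "\<lambda>A. of_bool (A \<inter> B \<noteq> {})"] by simp
  qed
  finally show ?thesis
    by (simp add: exp_of_nat_mult mult_left_mono divide_right_mono)
qed

text \<open>Union bound over the members of \<open>xs\<close> that meet \<open>B\<close>: each has
  at most \<open>K\<close> elements, so a fresh random set meets it with probability at most
  \<open>K * \<tau>\<close>.\<close>

lemma E_conflict_le:
  assumes fin: "finite (set_pmf q)"
    and xs: "\<And>A. A \<in> set xs \<Longrightarrow> finite A \<and> card A \<le> K"
    and h: "\<And>t. hit_prob q t \<le> \<tau>"
  shows "E q (\<lambda>C. of_bool (\<exists>A\<in>set xs. A \<inter> B \<noteq> {} \<and> A \<inter> C \<noteq> {})) \<le> real (meets B xs) * (real K * \<tau>)"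
  using xs
proof (induction xs)
  case (Cons A xs)
  let ?c = "\<lambda>xs C. \<exists>A\<in>set xs. A \<inter> B \<noteq> {} \<and> A \<inter> C \<noteq> {}"
  have "E q (\<lambda>C. of_bool (?c (A # xs) C)) \<le>
      E q (\<lambda>C. of_bool (A \<inter> B \<noteq> {}) * of_bool (C \<inter> A \<noteq> {}) + of_bool (?c xs C))"
    by (intro E_mono[OF fin]) (auto simp: Int_commute)
  also have "\<dots> = of_bool (A \<inter> B \<noteq> {}) * E q (\<lambda>C. of_bool (C \<inter> A \<noteq> {})) + E q (\<lambda>C. of_bool (?c xs C))"
    by (subst E_add[OF fin]) simp
  also have "\<dots> \<le> of_bool (A \<inter> B \<noteq> {}) * (real K * \<tau>) + real (meets B xs) * (real K * \<tau>)"
    using Cons by (intro add_mono mult_left_mono E_meets_le[OF fin _ _ h]) auto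
  also have "\<dots> = real (meets B (A # xs)) * (real K * \<tau>)"
    by (simp add: algebra_simps)
  finally show ?case .
qed simp

text \<open>
  The weights \<open>g\<close> make all sets in \<open>G\<close> contribute equally to the mean of \<open>Z\<close>.
\<close>

lemma second_moment:
  fixes p :: "'b pmf" and S :: "'b \<Rightarrow> 'a set" and g :: "'b \<Rightarrow> real"
  defines "q \<equiv> map_pmf S p"
  defines "Z \<equiv> \<lambda>xs. E p (\<lambda>y. g y * of_bool (S y \<subseteq> \<Union>(set xs)))"
  assumes fin: "finite (set_pmf p)"
    and S: "\<And>y. y \<in> set_pmf p \<Longrightarrow> finite (S y) \<and> card (S y) \<le> K"
    and h: "\<And>t. hit_prob q t \<le> \<tau>"
    and g: "\<And>y. 0 \<le> g y" "\<And>y. g y \<le> 1"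
    and eq: "\<And>y. g y * cover_prob q m (S y) = a * of_bool (y \<in> G)"
    and a: "0 < a"
  defines "\<gamma> \<equiv> E p (\<lambda>y. of_bool (y \<in> G))"
  assumes \<gamma>: "0 < \<gamma>"
  shows "E (replicate_pmf m q) (\<lambda>xs. of_bool (Z xs \<le> a * \<gamma> / 2)) \<le>
    4 * (real K * \<tau>) * (real M * a + real m * exp (real m * (real K * \<tau>)) / 2 ^ M) / (a * \<gamma>)\<^sup>2"
proof -
  let ?R = "replicate_pmf m q"
  let ?err = "real m * exp (real m * (real K * \<tau>)) / 2 ^ M"
  let ?conf = "\<lambda>xs y y'. \<exists>A\<in>set xs. A \<inter> S y \<noteq> {} \<and> A \<inter> S y' \<noteq> {}"
  let ?in = "\<lambda>y xs. S y \<subseteq> \<Union>(set xs)"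
  have finq: "finite (set_pmf q)"
    using fin by (simp add: q_def)
  have finR: "finite (set_pmf ?R)"
    by (rule finite_replicate_pmf[OF finq])
  have K\<tau>: "0 \<le> real K * \<tau>"
    using order_trans[OF hit_prob_nonneg h] by simp
  have EZ: "E ?R Z = a * \<gamma>"
  proof -
    have "E ?R Z = E p (\<lambda>y. E ?R (\<lambda>xs. g y * of_bool (?in y xs)))"
      unfolding Z_def by (rule E_swap[OF finR fin])
    also have "\<dots> = E p (\<lambda>y. a * of_bool (y \<in> G))"
      by (simp only: integral_mult_right_zero cover_prob_def[symmetric] eq)
    finally show ?thesis
      by (simp add: \<gamma>_def)
  qed
  \<comment> \<open>If no member of \<open>xs\<close> meets both sets, the disjointness condition of
    \<open>cover_prob_disjointly\<close> holds with \<open>X = S y\<close> and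
    \<open>Y = S y'\<close>.\<close>
  have far: "E ?R (\<lambda>xs. of_bool (?in y xs \<and> ?in y' xs \<and> \<not> ?conf xs y y')) \<le> cover_prob q m (S y) * cover_prob q m (S y')" for y y'
    using cover_prob_disjointly[OF finq order_refl order_refl, of m "S y" "S y'"]
    by (simp add: imp_conv_disj cong: conj_cong)
  \<comment> \<open>Pairs with a common witness are controlled only on average over
    \<open>y'\<close>. Coverage of \<open>S y'\<close> is dropped and the conflict alone is
    counted.\<close>
  have near: "E p (\<lambda>y'. E ?R (\<lambda>xs. of_bool (?in y xs \<and> ?conf xs y y')))
      \<le> real K * \<tau> * (real M * cover_prob q m (S y) + ?err)" if y: "y \<in> set_pmf p" for y
  proof -
    have "E p (\<lambda>y'. E ?R (\<lambda>xs. of_bool (?in y xs \<and> ?conf xs y y')))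
        = E ?R (\<lambda>xs. of_bool (?in y xs) * E p (\<lambda>y'. of_bool (?conf xs y y')))"
      by (subst E_swap[OF fin finR]) (simp add: of_bool_conj)
    also have "\<dots> \<le> E ?R (\<lambda>xs. of_bool (?in y xs) * (real (meets (S y) xs) * (real K * \<tau>)))"
    proof (intro E_mono[OF finR] mult_left_mono)
      fix xs assume "xs \<in> set_pmf ?R"
      then have "finite A \<and> card A \<le> K" if "A \<in> set xs" for A
        using that S by (auto simp: set_replicate_pmf q_def)
      then show "E p (\<lambda>y'. of_bool (?conf xs y y')) \<le> real (meets (S y) xs) * (real K * \<tau>)"
        using E_conflict_le[OF finq _ h, of xs K "S y"] by (simp add: q_def)
    qed simp
    also have "\<dots> = E ?R (\<lambda>xs. of_bool (?in y xs) * real (meets (S y) xs)) * (real K * \<tau>)"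
      by (simp flip: mult.assoc)
    also have "\<dots> \<le> (real M * cover_prob q m (S y) + ?err) * (real K * \<tau>)"
      using S[OF y] K\<tau> by (intro mult_right_mono E_meets_covered_le[OF finq _ _ h]) auto
    finally show ?thesis
      by (simp add: mult.commute)
  qed
  have "E ?R (\<lambda>xs. (Z xs)\<^sup>2) = E ?R (\<lambda>xs. E p (\<lambda>y. E p (\<lambda>y'. g y * g y' * of_bool (?in y xs \<and> ?in y' xs))))"
    by (simp add: Z_def power2_eq_square of_bool_conj mult_ac
        flip: integral_mult_right_zero integral_mult_left_zero)
  also have "\<dots> = E p (\<lambda>y. E p (\<lambda>y'. E ?R (\<lambda>xs. g y * g y' * of_bool (?in y xs \<and> ?in y' xs))))"
    by (subst E_swap[OF finR fin]) (simp only: E_swap[OF finR fin])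
  also have "\<dots> = E p (\<lambda>y. E p (\<lambda>y'. g y * g y' * E ?R (\<lambda>xs. of_bool (?in y xs \<and> ?in y' xs))))"
    by simp
  also have "\<dots> \<le> E p (\<lambda>y. E p (\<lambda>y'. (a * of_bool (y \<in> G)) * (a * of_bool (y' \<in> G)) +
      g y * E ?R (\<lambda>xs. of_bool (?in y xs \<and> ?conf xs y y'))))"
  proof (intro E_mono[OF fin])
    fix y y'
    have "E ?R (\<lambda>xs. of_bool (?in y xs \<and> ?in y' xs)) \<le>
        E ?R (\<lambda>xs. of_bool (?in y xs \<and> ?in y' xs \<and> \<not> ?conf xs y y') + of_bool (?in y xs \<and> ?conf xs y y'))"
      by (intro E_mono[OF finR]) auto
    also have "\<dots> \<le> cover_prob q m (S y) * cover_prob q m (S y') + E ?R (\<lambda>xs. of_bool (?in y xs \<and> ?conf xs y y'))"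
      using far by (subst E_add[OF finR]) simp
    finally have "g y * g y' * E ?R (\<lambda>xs. of_bool (?in y xs \<and> ?in y' xs)) \<le>
        g y * g y' * (cover_prob q m (S y) * cover_prob q m (S y') + E ?R (\<lambda>xs. of_bool (?in y xs \<and> ?conf xs y y')))"
      using g by (intro mult_left_mono) auto
    also have "\<dots> = (g y * cover_prob q m (S y)) * (g y' * cover_prob q m (S y')) +
        g y * g y' * E ?R (\<lambda>xs. of_bool (?in y xs \<and> ?conf xs y y'))"
      by (simp add: algebra_simps)
    \<comment> \<open>In the conflict term \<open>g y'\<close> is bounded by 1, so that averaging
      over \<open>y'\<close> leads to \<open>near\<close>; in the main term both weights are kept
      and yield \<open>a\<close> for each good set.\<close>
    also have "\<dots> \<le> (a * of_bool (y \<in> G)) * (a * of_bool (y' \<in> G)) +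
        g y * E ?R (\<lambda>xs. of_bool (?in y xs \<and> ?conf xs y y'))"
      unfolding eq using g by (intro add_left_mono mult_right_mono mult_left_le E_nonneg) auto
    finally show "g y * g y' * E ?R (\<lambda>xs. of_bool (?in y xs \<and> ?in y' xs)) \<le>
        (a * of_bool (y \<in> G)) * (a * of_bool (y' \<in> G)) +
        g y * E ?R (\<lambda>xs. of_bool (?in y xs \<and> ?conf xs y y'))" .
  qed
  also have "\<dots> = (a * \<gamma>)\<^sup>2 + E p (\<lambda>y. g y * E p (\<lambda>y'. E ?R (\<lambda>xs. of_bool (?in y xs \<and> ?conf xs y y'))))"
    by (simp add: E_add[OF fin] \<gamma>_def power2_eq_square mult_ac)
  \<comment> \<open>The weight cancels the cover probability left by \<open>near\<close>:
    \<open>g y * cover_prob q m (S y)\<close> is at most \<open>a\<close>.\<close>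
  also have "\<dots> \<le> (a * \<gamma>)\<^sup>2 + real K * \<tau> * (real M * a + ?err)"
  proof (intro add_left_mono E_le[OF fin])
    fix y assume "y \<in> set_pmf p"
    then have "g y * E p (\<lambda>y'. E ?R (\<lambda>xs. of_bool (?in y xs \<and> ?conf xs y y')))
      \<le> g y * (real K * \<tau> * (real M * cover_prob q m (S y) + ?err))"
      using g by (intro mult_left_mono near)
    also have "\<dots> = real K * \<tau> * (real M * (g y * cover_prob q m (S y)) + g y * ?err)"
      by (simp add: algebra_simps)
    also have "\<dots> \<le> real K * \<tau> * (real M * a + ?err)"
      unfolding eq using g a K\<tau>
      by (intro mult_left_mono add_mono mult_left_le_one_le) auto
    finally show "g y * E p (\<lambda>y'. E ?R (\<lambda>xs. of_bool (?in y xs \<and> ?conf xs y y'))) \<le>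
        real K * \<tau> * (real M * a + ?err)" .
  qed
  finally have "E ?R (\<lambda>xs. (Z xs)\<^sup>2) - (a * \<gamma>)\<^sup>2 \<le> real K * \<tau> * (real M * a + ?err)"
    by simp
  moreover have "E ?R (\<lambda>xs. (Z xs - a * \<gamma>)\<^sup>2) = E ?R (\<lambda>xs. (Z xs)\<^sup>2) - (a * \<gamma>)\<^sup>2"
  proof -
    have "E ?R (\<lambda>xs. (Z xs - a * \<gamma>)\<^sup>2) = E ?R (\<lambda>xs. (Z xs)\<^sup>2 - 2 * (a * \<gamma>) * Z xs + (a * \<gamma>)\<^sup>2)"
      by (simp add: power2_diff algebra_simps)
    also have "\<dots> = E ?R (\<lambda>xs. (Z xs)\<^sup>2) - 2 * (a * \<gamma>) * E ?R Z + (a * \<gamma>)\<^sup>2"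
      by (simp add: E_add[OF finR] E_diff[OF finR])
    finally show ?thesis
      by (simp add: EZ power2_eq_square)
  qed
  ultimately have var: "E ?R (\<lambda>xs. (Z xs - a * \<gamma>)\<^sup>2) \<le> real K * \<tau> * (real M * a + ?err)"
    by simp
  \<comment> \<open>Chebyshev's inequality: dropping to half of the mean \<open>a * \<gamma>\<close>
    is a deviation of at least \<open>a * \<gamma> / 2\<close>.\<close>
  have "E ?R (\<lambda>xs. of_bool (Z xs \<le> a * \<gamma> / 2)) \<le> E ?R (\<lambda>xs. of_bool ((a * \<gamma> / 2)\<^sup>2 \<le> (Z xs - a * \<gamma>)\<^sup>2))"
  proof (intro E_mono[OF finR])
    fix xs
    have "(a * \<gamma> / 2)\<^sup>2 \<le> (a * \<gamma> - Z xs)\<^sup>2" if "Z xs \<le> a * \<gamma> / 2"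
    proof (rule power_mono)
      show "a * \<gamma> / 2 \<le> a * \<gamma> - Z xs"
        using that by linarith
    qed (use a \<gamma> in simp)
    then show "of_bool (Z xs \<le> a * \<gamma> / 2) \<le> (of_bool ((a * \<gamma> / 2)\<^sup>2 \<le> (Z xs - a * \<gamma>)\<^sup>2) :: real)"
      by (auto simp: power2_commute mult.commute)
  qed
  also have "\<dots> \<le> E ?R (\<lambda>xs. (Z xs - a * \<gamma>)\<^sup>2) / (a * \<gamma> / 2)\<^sup>2"
    using a \<gamma> by (intro E_Markov[OF finR]) auto
  also have "\<dots> \<le> real K * \<tau> * (real M * a + ?err) / (a * \<gamma> / 2)\<^sup>2"
    by (intro divide_right_mono var) simp
  finally show ?thesis
    by (simp add: power_divide field_simps)
qed

section \<open>The extremal inequality behind the constant\<close>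

text \<open>The product is symmetric about 1/2 and nondecreasing to the left of it, so its maximum
  is at 1/2.\<close>

lemma ln_mult_ln_le:
  fixes u :: real
  assumes "0 < u" "u < 1"
  shows "ln u * ln (1 - u) \<le> (ln 2)\<^sup>2"
proof -
  have less: "ln u * ln (1 - u) \<le> (ln 2)\<^sup>2" if u: "0 < u" "u < 1 / 2" for u :: real
  proof -
    \<comment> \<open>This is the sign of the derivative. It is concavity of \<open>ln\<close> at
      \<open>1 - v\<close>, written as the convex combination of 1 and \<open>v\<close> in which
      \<open>v\<close> has weight \<open>v / (1 - v)\<close>.\<close>
    have concave: "v * ln v \<le> (1 - v) * ln (1 - v)" if v: "0 < v" "v \<le> 1 / 2" for v :: real
    proof -
      have "(1 - v / (1 - v)) * ln 1 + v / (1 - v) * ln v \<le> ln ((1 - v / (1 - v)) *\<^sub>R 1 + (v / (1 - v)) *\<^sub>R v)"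
        using v by (intro concave_onD[OF ln_concave]) (auto simp: field_simps)
      also have "(1 - v / (1 - v)) *\<^sub>R 1 + (v / (1 - v)) *\<^sub>R v = 1 - v / (1 - v) * (1 - v)"
        unfolding real_scaleR_def by algebra
      also have "v / (1 - v) * (1 - v) = v"
        using v by (subst nonzero_eq_divide_eq[symmetric]) auto
      finally show ?thesis
        using v by (simp add: field_simps)
    qed
    have "ln u * ln (1 - u) \<le> ln (1 / 2) * ln (1 - 1 / 2)"
    proof (rule DERIV_nonneg_imp_nondecreasing[where f = "\<lambda>u. ln u * ln (1 - u)"])
      fix v :: real assume v: "u \<le> v" "v \<le> 1 / 2"
      have "((\<lambda>u. ln u * ln (1 - u)) has_real_derivative
          ((1 - v) * ln (1 - v) - v * ln v) / (v * (1 - v))) (at v)"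
        using u v by (auto intro!: derivative_eq_intros simp: field_simps)
      moreover have "0 \<le> ((1 - v) * ln (1 - v) - v * ln v) / (v * (1 - v))"
        using concave[of v] u v by (intro divide_nonneg_pos) auto
      ultimately show "\<exists>y. ((\<lambda>u. ln u * ln (1 - u)) has_real_derivative y) (at v) \<and> 0 \<le> y"
        by blast
    qed (use u in auto)
    then show ?thesis
      by (simp add: ln_div power2_eq_square)
  qed
  consider "u < 1 / 2" | "1 - u < 1 / 2" | "u = 1 / 2"
    by linarith
  then show ?thesis
  proof cases
    case 3
    show ?thesis
      unfolding 3 by (simp add: ln_div power2_eq_square)
  qed (use less[of u] less[of "1 - u"] assms in \<open>auto simp: mult.commute\<close>)
qed

section \<open>Covering group and testing group\<close>

lemma E_replicate_all:
  assumes fin: "finite (set_pmf p)"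
  shows "E (replicate_pmf m p) (\<lambda>xs. of_bool (\<forall>x\<in>set xs. P x)) = E p (\<lambda>x. of_bool (P x)) ^ m"
proof (induction m)
  case (Suc m)
  show ?case
    by (subst E_replicate_Suc[OF fin]) (simp add: of_bool_conj Suc.IH)
qed simp

lemma E_not: "finite (set_pmf p) \<Longrightarrow> E p (\<lambda>x. of_bool (\<not> P x)) = 1 - E p (\<lambda>x. of_bool (P x))"
  by (simp add: of_bool_not_iff E_diff)

text \<open>Positions are used rather than members because several leaves may pick the same set;
  such leaves block one another.\<close>

definition blocked :: "'a set list \<Rightarrow> nat \<Rightarrow> bool" where
  "blocked zs i \<longleftrightarrow> zs ! i \<subseteq> (\<Union>j\<in>{..<length zs} - {i}. zs ! j)"

lemma blocked_append:
  assumes "y \<in> set ys" "y \<subseteq> \<Union>(set xs)"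
  shows "\<exists>i<length (xs @ ys). blocked (xs @ ys) i"
proof -
  obtain k where k: "k < length ys" "y = ys ! k"
    using assms(1) by (auto simp: in_set_conv_nth)
  have "\<Union>(set xs) \<subseteq> (\<Union>j\<in>{..<length (xs @ ys)} - {length xs + k}. (xs @ ys) ! j)"
    by (force simp: in_set_conv_nth nth_append)
  then show ?thesis
    using assms(2) k by (intro exI[of _ "length xs + k"]) (auto simp: blocked_def nth_append)
qed

text \<open>The first \<open>m\<close> sets cover, the last \<open>r\<close> are tested against
  these only. Given the covering group the tests are independent, whence the power
  \<open>r\<close>.\<close>

lemma E_none_blocked_le:
  assumes fin: "finite (set_pmf p)"
  shows "E (replicate_pmf (m + r) p) (\<lambda>zs. of_bool (\<forall>i<length zs. \<not> blocked zs i)) \<le>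
    E (replicate_pmf m p) (\<lambda>xs. (1 - E p (\<lambda>y. of_bool (y \<subseteq> \<Union>(set xs)))) ^ r)"
proof -
  have "E (replicate_pmf r p) (\<lambda>ys. of_bool (\<forall>i<length (xs @ ys). \<not> blocked (xs @ ys) i)) \<le>
      (1 - E p (\<lambda>y. of_bool (y \<subseteq> \<Union>(set xs)))) ^ r" for xs
  proof -
    have "E (replicate_pmf r p) (\<lambda>ys. of_bool (\<forall>i<length (xs @ ys). \<not> blocked (xs @ ys) i)) \<le>
        E (replicate_pmf r p) (\<lambda>ys. of_bool (\<forall>y\<in>set ys. \<not> y \<subseteq> \<Union>(set xs)))"
    proof (intro E_mono finite_replicate_pmf fin)
      fix ys
      show "of_bool (\<forall>i<length (xs @ ys). \<not> blocked (xs @ ys) i) \<le>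
          (of_bool (\<forall>y\<in>set ys. \<not> y \<subseteq> \<Union>(set xs)) :: real)"
        using blocked_append[of _ ys xs] unfolding of_bool_def by (smt (verit, best))
    qed
    then show ?thesis
      by (simp only: E_replicate_all[OF fin] E_not[OF fin])
  qed
  then show ?thesis
    by (subst E_replicate_add[OF fin]) (intro E_mono finite_replicate_pmf fin)
qed

section \<open>The mean logarithmic cost of covering a set\<close>

lemma mult_neg_ln_one_minus_exp_le:
  fixes x :: real
  assumes "0 \<le> x"
  shows "x * - ln (1 - exp (- x)) \<le> (ln 2)\<^sup>2"
  using ln_mult_ln_le[of "exp (- x)"] assms by (cases "x = 0") auto

text \<open>A time contributes to the mean its hit probability times its cost, and by the extremal
  inequality this is at most \<open>(ln 2)^2 / l\<close>, whatever the distribution.\<close>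

lemma E_cost_le:
  assumes fin: "finite (set_pmf q)" and sub: "\<And>A. A \<in> set_pmf q \<Longrightarrow> A \<subseteq> {..<T :: nat}" and l: "0 < l"
  shows "E q (\<lambda>A. \<Sum>t\<in>A. - ln (1 - exp (- (l * hit_prob q t)))) \<le> real T * (ln 2)\<^sup>2 / l"
proof -
  let ?w = "\<lambda>t. - ln (1 - exp (- (l * hit_prob q t)))"
  have "E q (\<lambda>A. \<Sum>t\<in>A. ?w t) = E q (\<lambda>A. \<Sum>t<T. of_bool (t \<in> A) * ?w t)"
  proof (rule E_cong)
    fix A assume "A \<in> set_pmf q"
    then have "{..<T} \<inter> {t. t \<in> A} = A"
      using sub by auto
    then show "(\<Sum>t\<in>A. ?w t) = (\<Sum>t<T. of_bool (t \<in> A) * ?w t)"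
      by (subst sum_of_bool_mult_eq) auto
  qed
  also have "\<dots> = (\<Sum>t<T. hit_prob q t * ?w t)"
    by (subst E_sum[OF fin]) (simp only: integral_mult_left_zero hit_prob_def)
  also have "\<dots> \<le> (\<Sum>t<T. (ln 2)\<^sup>2 / l)"
  proof (rule sum_mono)
    fix t
    show "hit_prob q t * ?w t \<le> (ln 2)\<^sup>2 / l"
      using mult_neg_ln_one_minus_exp_le[of "l * hit_prob q t"] l hit_prob_nonneg[of q t]
      by (simp add: field_simps)
  qed
  finally show ?thesis
    by simp
qed

lemma cover_prob_ge_exp_cost:
  assumes fin: "finite (set_pmf q)" and A: "A \<in> set_pmf q" "finite A" and d: "0 < d" "d < 1 / 2" and m: "0 < m"
  shows "exp (- (\<Sum>t\<in>A. - ln (1 - exp (- ((1 - 2 * d) * real m * hit_prob q t))))) - exp (- (d\<^sup>2 * real m))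
    \<le> cover_prob q m A"
proof -
  \<comment> \<open>Since \<open>A\<close> itself has positive probability, each of its times is hit
    with positive probability. The factors are thus positive and really equal \<open>exp\<close> of
    their logarithms.\<close>
  have "1 - exp (- ((1 - 2 * d) * real m * hit_prob q t)) > 0" if "t \<in> A" for t
  proof -
    have "0 < pmf q A * of_bool (t \<in> A)"
      using A that by (simp add: pmf_positive)
    also have "\<dots> \<le> hit_prob q t"
      unfolding hit_prob_def E_finite[OF fin] using A fin by (intro member_le_sum) auto
    finally show ?thesis
      using d m by simp
  qed
  then have "exp (- (\<Sum>t\<in>A. - ln (1 - exp (- ((1 - 2 * d) * real m * hit_prob q t))))) =
      (\<Prod>t\<in>A. 1 - exp (- ((1 - 2 * d) * real m * hit_prob q t)))"
    using A by (simp add: sum_negf exp_sum)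
  then show ?thesis
    using cover_prob_ge[OF fin A(2) d(1), of m] d by simp
qed

section \<open>Bounds for the probability that no leaf is blocked\<close>

text \<open>The three error terms are: the covering group misses a time of hit probability above
  \<open>\<tau>\<close>; the weighted fraction of covered sets falls below half its mean; no testing
  set is covered although each has a chance of at least \<open>a * \<gamma>0 / 2\<close>. The number
  \<open>\<gamma>0\<close> bounds from below the probability of a good set, after removing by
  Markov's inequality sets of cost at least \<open>b\<close> and sets with more than
  \<open>K\<close> light times.\<close>

lemma none_blocked_bound:
  fixes p :: "nat set pmf" and T m r K M :: nat and \<tau> a b d :: real
  assumes sub: "\<And>A. A \<in> set_pmf p \<Longrightarrow> A \<subseteq> {..<T}"
    and \<tau>: "0 < \<tau>" and d: "0 < d" "d < 1 / 2" and m: "0 < m" and b: "0 < b"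
    and a: "0 < a" "a \<le> exp (- b) - exp (- (d\<^sup>2 * real m))"
    and \<gamma>0: "0 < \<gamma>0" "\<gamma>0 + real T * (ln 2)\<^sup>2 / ((1 - 2 * d) * real m * b) + real T * \<tau> / real (Suc K) \<le> 1"
  shows "E (replicate_pmf (m + r) p) (\<lambda>zs. of_bool (\<forall>i<length zs. \<not> blocked zs i)) \<le>
     real T * exp (- (\<tau> * real m)) +
     4 * (real K * \<tau>) * (real M * a + real m * exp (real m * (real K * \<tau>)) / 2 ^ M) / (a * \<gamma>0)\<^sup>2 +
     exp (- (real r * (a * \<gamma>0 / 2)))"
proof -
  \<comment> \<open>The times outside \<open>L\<close> are covered anyway. Sets that are too large play no role as tests and,
    replaced by the empty set, do not help to cover.\<close>
  define L where "L = {t. t < T \<and> hit_prob p t \<le> \<tau>}"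
  define S where "S A = (if card (A \<inter> L) \<le> K then A \<inter> L else {})" for A
  define q where "q = map_pmf S p"
  define l where "l = (1 - 2 * d) * real m"
  define cost where "cost A = (\<Sum>t\<in>A. - ln (1 - exp (- (l * hit_prob q t))))" for A
  define G where "G = {A. card (A \<inter> L) \<le> K \<and> a \<le> cover_prob q m (S A)}"
  define \<gamma> where "\<gamma> = E p (\<lambda>A. of_bool (A \<in> G))"
  define g where "g A = (if A \<in> G then a / cover_prob q m (S A) else 0)" for A
  define Z where "Z xs = E p (\<lambda>A. g A * of_bool (S A \<subseteq> \<Union>(set xs)))" for xs
  let ?Rp = "replicate_pmf m p" and ?Rq = "replicate_pmf m q"
  have fin: "finite (set_pmf p)"
    using sub by (auto intro: finite_subset[where B = "Pow {..<T}"])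
  have finq: "finite (set_pmf q)"
    using fin by (simp add: q_def)
  have finR: "finite (set_pmf ?Rp)"
    by (rule finite_replicate_pmf[OF fin])
  have finL: "finite L"
    by (simp add: L_def)
  have finS: "finite (S A)" for A
    using finL by (auto simp: S_def)
  have l: "0 < l"
    using d m by (simp add: l_def)
  have hit_prob_q: "hit_prob q t \<le> \<tau>" for t
  proof (cases "t \<in> L")
    case True
    have "hit_prob q t = E p (\<lambda>A. of_bool (t \<in> S A))"
      by (simp add: hit_prob_def q_def)
    also have "\<dots> \<le> E p (\<lambda>A. of_bool (t \<in> A))"
      by (intro E_mono[OF fin]) (auto simp: S_def split: if_splits)
    also have "\<dots> \<le> \<tau>"
      using True by (simp add: L_def hit_prob_def)
    finally show ?thesis .
  next
    case False
    then have "t \<notin> S A" for A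
      by (simp add: S_def)
    then show ?thesis
      using \<tau> by (simp add: hit_prob_def q_def)
  qed

  have \<gamma>: "\<gamma>0 \<le> \<gamma>"
  proof -
    have "E p (\<lambda>A. of_bool (b \<le> cost (S A))) \<le> E p (\<lambda>A. cost (S A)) / b"
    proof (rule E_Markov[OF fin _ b])
      have "ln (1 - exp (- (l * hit_prob q t))) \<le> 0" for t
        using l hit_prob_nonneg[of q t] by (cases "hit_prob q t = 0") (auto simp: ln_le_zero_iff less_le)
      then show "0 \<le> cost (S A)" for A
        unfolding cost_def by (intro sum_nonneg) simp
    qed
    also have "E p (\<lambda>A. cost (S A)) = E q cost"
      by (simp add: q_def)
    also have "E q cost / b \<le> real T * (ln 2)\<^sup>2 / l / b"
      unfolding cost_def using b sub
      by (intro divide_right_mono E_cost_le[OF finq _ l]) (auto simp: q_def S_def L_def split: if_splits)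
    finally have 1: "E p (\<lambda>A. of_bool (b \<le> cost (S A))) \<le> real T * (ln 2)\<^sup>2 / (l * b)"
      by simp
    have "E p (\<lambda>A. of_bool (real (Suc K) \<le> real (card (A \<inter> L)))) \<le> E p (\<lambda>A. real (card (A \<inter> L))) / real (Suc K)"
      by (intro E_Markov[OF fin]) auto
    also have "E p (\<lambda>A. real (card (A \<inter> L))) = (\<Sum>t\<in>L. hit_prob p t)"
    proof -
      have "E p (\<lambda>A. real (card (A \<inter> L))) = E p (\<lambda>A. \<Sum>t\<in>L. of_bool (t \<in> A))"
        by (intro E_cong) (simp add: finL Int_def conj_commute)
      then show ?thesis
        by (simp add: E_sum[OF fin] hit_prob_def)
    qed
    also have "(\<Sum>t\<in>L. hit_prob p t) \<le> real (card L) * \<tau>"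
      using sum_mono[of L "hit_prob p" "\<lambda>_. \<tau>"] by (simp add: L_def)
    also have "\<dots> \<le> real T * \<tau>"
      using card_mono[of "{..<T}" L] \<tau> by (intro mult_right_mono) (auto simp: L_def)
    finally have 2: "E p (\<lambda>A. of_bool (real (Suc K) \<le> real (card (A \<inter> L)))) \<le> real T * \<tau> / real (Suc K)"
      by (simp add: divide_right_mono)
    have "1 \<le> E p (\<lambda>A. of_bool (A \<in> G) + (of_bool (b \<le> cost (S A)) + of_bool (real (Suc K) \<le> real (card (A \<inter> L)))))"
    proof -
      have "E p (\<lambda>A. 1) \<le> E p (\<lambda>A. of_bool (A \<in> G) + (of_bool (b \<le> cost (S A)) + of_bool (real (Suc K) \<le> real (card (A \<inter> L)))))"
      proof (rule E_mono[OF fin])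
        fix A assume A: "A \<in> set_pmf p"
        \<comment> \<open>Cost below \<open>b\<close> makes the Poisson product exceed
          \<open>exp (- b)\<close>; the hypothesis on \<open>a\<close> allows for the error of
          passing to exactly \<open>m\<close> sets.\<close>
        have "A \<in> G" if "cost (S A) < b" "card (A \<inter> L) \<le> K"
        proof -
          have "a \<le> exp (- cost (S A)) - exp (- (d\<^sup>2 * real m))"
            using a(2) that(1) by (smt (verit) exp_less_mono)
          also have "\<dots> \<le> cover_prob q m (S A)"
            unfolding cost_def l_def using A finS d m
            by (intro cover_prob_ge_exp_cost[OF finq]) (auto simp: q_def)
          finally show ?thesis
            using that by (simp add: G_def)
        qed
        then show "1 \<le> of_bool (A \<in> G) + (of_bool (b \<le> cost (S A)) +
            of_bool (real (Suc K) \<le> real (card (A \<inter> L))) :: real)"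
          by (auto simp: not_le)
      qed
      then show ?thesis
        by simp
    qed
    also have "\<dots> = \<gamma> + (E p (\<lambda>A. of_bool (b \<le> cost (S A))) + E p (\<lambda>A. of_bool (real (Suc K) \<le> real (card (A \<inter> L)))))"
      by (simp only: E_add[OF fin] \<gamma>_def)
    finally show ?thesis
      using 1 2 \<gamma>0(2) unfolding l_def by linarith
  qed
  have "0 < \<gamma>"
    using \<gamma> \<gamma>0 by simp
  have "\<gamma> \<le> 1"
    unfolding \<gamma>_def by (rule E_le[OF fin]) simp

  have g: "0 \<le> g A" "g A \<le> 1" "g A * cover_prob q m (S A) = a * of_bool (A \<in> G)" for A
    using a(1) by (auto simp: g_def G_def field_simps)
  have "E ?Rq (\<lambda>xs. of_bool (Z xs \<le> a * \<gamma> / 2)) \<le>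
      4 * (real K * \<tau>) * (real M * a + real m * exp (real m * (real K * \<tau>)) / 2 ^ M) / (a * \<gamma>)\<^sup>2"
    unfolding Z_def q_def \<gamma>_def
  proof (rule second_moment[OF fin])
    show "finite (S A) \<and> card (S A) \<le> K" if "A \<in> set_pmf p" for A
      using finS by (simp add: S_def)
  qed (use g hit_prob_q a(1) \<open>0 < \<gamma>\<close> in \<open>auto simp: q_def \<gamma>_def\<close>)
  also have "\<dots> \<le> 4 * (real K * \<tau>) * (real M * a + real m * exp (real m * (real K * \<tau>)) / 2 ^ M) / (a * \<gamma>0)\<^sup>2"
    using a(1) \<tau> \<gamma>0(1) \<gamma> by (intro divide_left_mono power_mono mult_left_mono mult_pos_pos zero_less_power) auto
  finally have Z_small: "E ?Rq (\<lambda>xs. of_bool (Z xs \<le> a * \<gamma> / 2)) \<le>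
      4 * (real K * \<tau>) * (real M * a + real m * exp (real m * (real K * \<tau>)) / 2 ^ M) / (a * \<gamma>0)\<^sup>2" .

  have uncovered: "E ?Rp (\<lambda>xs. of_bool (t \<notin> \<Union>(set xs))) \<le> exp (- (\<tau> * real m))" if "t \<in> {..<T} - L" for t
  proof -
    have "E ?Rp (\<lambda>xs. of_bool (t \<notin> \<Union>(set xs))) = (1 - hit_prob p t) ^ m"
      using E_replicate_all[OF fin, of m "\<lambda>x. t \<notin> x"] by (simp add: E_not[OF fin] hit_prob_def)
    also have "\<dots> \<le> exp (- \<tau>) ^ m"
      using that hit_prob_le_1[OF fin, of t] exp_ge_add_one_self[of "- \<tau>"]
      by (intro power_mono) (auto simp: L_def)
    finally show ?thesis
      by (simp add: exp_of_nat_mult[symmetric] mult.commute)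
  qed

  have "E (replicate_pmf (m + r) p) (\<lambda>zs. of_bool (\<forall>i<length zs. \<not> blocked zs i)) \<le>
      E ?Rp (\<lambda>xs. (1 - E p (\<lambda>y. of_bool (y \<subseteq> \<Union>(set xs)))) ^ r)"
    by (rule E_none_blocked_le[OF fin])
  also have "\<dots> \<le> E ?Rp (\<lambda>xs. (\<Sum>t\<in>{..<T} - L. of_bool (t \<notin> \<Union>(set xs))) +
      (of_bool (Z (map S xs) \<le> a * \<gamma> / 2) + exp (- (real r * (a * \<gamma>0 / 2)))))"
  proof (rule E_mono[OF finR])
    fix xs
    let ?P = "E p (\<lambda>y. of_bool (y \<subseteq> \<Union>(set xs)))"
    have P1: "0 \<le> 1 - ?P" "1 - ?P \<le> 1"
      using E_le[OF fin, of "\<lambda>y. of_bool (y \<subseteq> \<Union>(set xs))" 1] E_nonneg[of p "\<lambda>y. of_bool (y \<subseteq> \<Union>(set xs))"]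
      by auto
    then have pow: "(1 - ?P) ^ r \<le> 1"
      by (rule power_le_one)
    have nonneg: "0 \<le> (\<Sum>t\<in>{..<T} - L. of_bool (t \<notin> \<Union>(set xs)) :: real)"
      by (intro sum_nonneg) auto
    \<comment> \<open>In the first two cases the power is bounded by 1 and charged to the
      corresponding indicator; only the third uses the independence of the tests.\<close>
    consider t where "t \<in> {..<T} - L" "t \<notin> \<Union>(set xs)" | "Z (map S xs) \<le> a * \<gamma> / 2"
      | "{..<T} - L \<subseteq> \<Union>(set xs)" "a * \<gamma> / 2 < Z (map S xs)"
      by fastforce
    then show "(1 - ?P) ^ r \<le> (\<Sum>t\<in>{..<T} - L. of_bool (t \<notin> \<Union>(set xs))) +
        (of_bool (Z (map S xs) \<le> a * \<gamma> / 2) + exp (- (real r * (a * \<gamma>0 / 2))))"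
    proof cases
      case 1
      have "1 \<le> (\<Sum>t\<in>{..<T} - L. of_bool (t \<notin> \<Union>(set xs)) :: real)"
        using member_le_sum[of t "{..<T} - L" "\<lambda>t. of_bool (t \<notin> \<Union>(set xs)) :: real"] 1 by simp
      then show ?thesis
        using pow by (smt (verit) exp_gt_zero zero_less_eq_of_bool)
    next
      case 2
      then show ?thesis
        using pow nonneg by (smt (verit) exp_gt_zero of_bool_eq_1_iff)
    next
      case 3
      \<comment> \<open>The weights are at most 1 and vanish outside \<open>G\<close>. For
        \<open>A\<close> in \<open>G\<close> the truncated sets cover its times in \<open>L\<close>,
        and in this case all other times are covered too.\<close>
      have "Z (map S xs) \<le> ?P"
        unfolding Z_def
      proof (rule E_mono[OF fin])
        fix A assume A: "A \<in> set_pmf p"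
        have "A \<subseteq> \<Union>(set xs)" if "A \<in> G" "S A \<subseteq> \<Union>(set (map S xs))"
        proof -
          have "A \<subseteq> S A \<union> ({..<T} - L)"
            using that sub[OF A] by (auto simp: S_def G_def)
          moreover have "\<Union>(set (map S xs)) \<subseteq> \<Union>(set xs)"
            by (auto simp: S_def split: if_splits)
          ultimately show ?thesis
            using that(2) 3(1) by blast
        qed
        then show "g A * of_bool (S A \<subseteq> \<Union>(set (map S xs))) \<le> of_bool (A \<subseteq> \<Union>(set xs))"
          using g(2)[of A] by (auto simp: g_def)
      qed
      moreover have "a * \<gamma>0 / 2 \<le> a * \<gamma> / 2"
        using \<gamma> a by simp
      ultimately have "1 - ?P \<le> exp (- (a * \<gamma>0 / 2))"
        using 3(2) exp_ge_add_one_self[of "- (a * \<gamma>0 / 2)"] by linarith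
      then have "(1 - ?P) ^ r \<le> exp (- (a * \<gamma>0 / 2)) ^ r"
        using P1 by (intro power_mono)
      also have "\<dots> = exp (- (real r * (a * \<gamma>0 / 2)))"
        by (simp add: exp_of_nat_mult[symmetric])
      finally show ?thesis
        using nonneg by (smt (verit) exp_gt_zero zero_less_eq_of_bool)
    qed
  qed
  also have "\<dots> = (\<Sum>t\<in>{..<T} - L. E ?Rp (\<lambda>xs. of_bool (t \<notin> \<Union>(set xs)))) +
      (E ?Rp (\<lambda>xs. of_bool (Z (map S xs) \<le> a * \<gamma> / 2)) + exp (- (real r * (a * \<gamma>0 / 2))))"
    by (simp only: E_add[OF finR] E_sum[OF finR] E_const)
  also have "E ?Rp (\<lambda>xs. of_bool (Z (map S xs) \<le> a * \<gamma> / 2)) = E ?Rq (\<lambda>xs. of_bool (Z xs \<le> a * \<gamma> / 2))"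
    by (simp add: q_def replicate_pmf_map)
  also have "(\<Sum>t\<in>{..<T} - L. E ?Rp (\<lambda>xs. of_bool (t \<notin> \<Union>(set xs)))) \<le> real T * exp (- (\<tau> * real m))"
  proof -
    have "(\<Sum>t\<in>{..<T} - L. E ?Rp (\<lambda>xs. of_bool (t \<notin> \<Union>(set xs)))) \<le> (\<Sum>t\<in>{..<T} - L. exp (- (\<tau> * real m)))"
      by (intro sum_mono uncovered)
    also have "\<dots> \<le> real T * exp (- (\<tau> * real m))"
      using card_mono[of "{..<T}" "{..<T} - L"] by (simp add: mult_right_mono)
    finally show ?thesis .
  qed
  finally show ?thesis
    using Z_small by simp
qed

lemma none_blocked_asymptotics:
  fixes c :: real
  assumes c: "0 < c" "c < 1 / (ln 2)\<^sup>2"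
  shows "\<exists>e. e \<longlonglongrightarrow> 0 \<and> (\<forall>\<^sub>F n in sequentially. \<forall>p T.
    (\<forall>A\<in>set_pmf p. A \<subseteq> {..<T}) \<longrightarrow> real T \<le> c * (real n * ln (real n)) \<longrightarrow>
    E (replicate_pmf n p) (\<lambda>zs. of_bool (\<forall>i<length zs. \<not> blocked zs i)) \<le> e n)"
proof -
  \<comment> \<open>The slack is split into six: one part for the testing group, two for the lowered
    Poisson mean, two for \<open>b\<close>, and one that survives Markov's inequality. This is the
    estimate \<open>(1 - \<epsilon>)^2 * (1 - 2 * \<epsilon>)^2 >= 1 - 6 * \<epsilon>\<close>
    below.\<close>
  define \<epsilon> where "\<epsilon> = (1 - c * (ln 2)\<^sup>2) / 6"
  have \<epsilon>: "0 < \<epsilon>" "\<epsilon> < 1 / 6" and c\<epsilon>: "c * (ln 2)\<^sup>2 = 1 - 6 * \<epsilon>"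
    using c by (auto simp: \<epsilon>_def field_simps)
  \<comment> \<open>With at least \<open>(1 - \<epsilon>) * n\<close> covering leaves and
    \<open>\<epsilon> < 1 / 6\<close>, a heavier time is missed with probability at most
    \<open>n\<close> to the power -5, which outweighs the number of times.\<close>
  define \<tau> where "\<tau> n = 6 * ln (real n) / real n" for n
  define a where "a n = real n powr (\<epsilon> - 1)" for n
  define e where "e n = c * (real n * ln (real n)) * exp (- (5 * ln (real n))) +
     4 * (real n powr (\<epsilon> / 4) * \<tau> n) * ((real n powr (\<epsilon> / 2) + 1) * a n +
       real n * exp (6 * real n powr (\<epsilon> / 4) * ln (real n)) / exp (real n powr (\<epsilon> / 2) * ln 2)) /
       (a n * (\<epsilon> / 2))\<^sup>2 +
     exp (- ((\<epsilon> * real n - 1) * (a n * (\<epsilon> / 2) / 2)))" for n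
  have 1: "(\<lambda>n::nat. c * (real n * ln (real n)) * exp (- (5 * ln (real n)))) \<longlonglongrightarrow> 0"
    by real_asymp
  have 2: "(\<lambda>n::nat. 4 * (real n powr (\<epsilon> / 4) * (6 * ln (real n) / real n)) * ((real n powr (\<epsilon> / 2) + 1) * (real n powr (\<epsilon> - 1)) +
       real n * exp (6 * real n powr (\<epsilon> / 4) * ln (real n)) / exp (real n powr (\<epsilon> / 2) * ln 2)) /
       (real n powr (\<epsilon> - 1) * (\<epsilon> / 2))\<^sup>2) \<longlonglongrightarrow> 0"
    using \<epsilon> by real_asymp
  have 3: "(\<lambda>n::nat. exp (- ((\<epsilon> * real n - 1) * (real n powr (\<epsilon> - 1) * (\<epsilon> / 2) / 2)))) \<longlonglongrightarrow> 0"
    using \<epsilon> by real_asymp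
  have "e \<longlonglongrightarrow> 0"
    unfolding e_def[abs_def] \<tau>_def a_def using tendsto_add[OF tendsto_add[OF 1 2] 3] by simp
  have ev1: "\<forall>\<^sub>F n::nat in sequentially. real n powr (\<epsilon> - 1) \<le>
      real n powr (2 * \<epsilon> - 1) - exp (- (\<epsilon>\<^sup>2 * ((1 - \<epsilon>) * real n)))"
  proof -
    have "\<forall>\<^sub>F n::nat in sequentially. exp (- (\<epsilon>\<^sup>2 * ((1 - \<epsilon>) * real n))) \<le> real n powr - 1"
      using \<epsilon> by real_asymp
    moreover have "\<forall>\<^sub>F n::nat in sequentially. real n powr (\<epsilon> - 1) + real n powr - 1 \<le> real n powr (2 * \<epsilon> - 1)"
      using \<epsilon> by real_asymp
    ultimately show ?thesis
      by eventually_elim simp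
  qed
  have ev2: "\<forall>\<^sub>F n::nat in sequentially. c * (real n * ln (real n)) * (6 * ln (real n) / real n) / (real n powr (\<epsilon> / 4)) \<le> \<epsilon> / 2"
    using \<epsilon> c(1) by real_asymp
  have bound: "\<forall>\<^sub>F n in sequentially. \<forall>p T.
    (\<forall>A\<in>set_pmf p. A \<subseteq> {..<T}) \<longrightarrow> real T \<le> c * (real n * ln (real n)) \<longrightarrow>
    E (replicate_pmf n p) (\<lambda>zs. of_bool (\<forall>i<length zs. \<not> blocked zs i)) \<le> e n"
    using ev1 ev2 eventually_ge_at_top[of 3]
  proof eventually_elim
    case (elim n)
    show ?case
    proof (intro allI impI)
      fix p :: "nat set pmf" and T
      assume sub: "\<forall>A\<in>set_pmf p. A \<subseteq> {..<T}" and T: "real T \<le> c * (real n * ln (real n))"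
      define r where "r = nat \<lfloor>\<epsilon> * real n\<rfloor>"
      define m where "m = n - r"
      \<comment> \<open>The exponents are chosen so that \<open>2 ^ M\<close> dominates
        \<open>exp (m * K * \<tau>)\<close>, as 1/4 < 1/2, while \<open>K * M * \<tau> / a\<close>
        still tends to 0, as 1/4 + 1/2 < 1.\<close>
      define K where "K = nat \<lfloor>real n powr (\<epsilon> / 4)\<rfloor>"
      define M where "M = nat \<lceil>real n powr (\<epsilon> / 2)\<rceil>"
      \<comment> \<open>Then \<open>exp (- b)\<close> is \<open>n\<close> to the power
        \<open>2 * \<epsilon> - 1\<close>, larger than \<open>a n\<close> by a factor that absorbs
        the exponentially small error.\<close>
      define b where "b = (1 - 2 * \<epsilon>) * ln (real n)"
      have n: "3 \<le> real n"
        using elim(3) by simp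
      have ln_n: "0 < ln (real n)"
        using n by simp
      have r: "\<epsilon> * real n - 1 \<le> real r" "real r \<le> \<epsilon> * real n"
        using \<epsilon> n unfolding r_def by (auto simp: of_nat_nat)
      moreover have "\<epsilon> * real n \<le> 1 * real n"
        using \<epsilon> by (intro mult_right_mono) auto
      ultimately have "r \<le> n"
        by linarith
      then have mr: "m + r = n" and m_real: "real m = real n - real r"
        by (simp_all add: m_def of_nat_diff)
      have m: "(1 - \<epsilon>) * real n \<le> real m" "real m \<le> real n"
        using r(2) by (simp_all add: m_real algebra_simps)
      have m_pos: "0 < real m"
        using m(1) \<epsilon> n by (intro less_le_trans[OF mult_pos_pos m(1)]) auto
      have K: "real K \<le> real n powr (\<epsilon> / 4)" "real n powr (\<epsilon> / 4) \<le> real (Suc K)"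
        unfolding K_def by (simp_all add: of_nat_nat) linarith
      have M: "real n powr (\<epsilon> / 2) \<le> real M" "real M \<le> real n powr (\<epsilon> / 2) + 1"
        unfolding M_def by (simp_all add: of_nat_nat)
      have \<tau>: "0 < \<tau> n"
        using n ln_n by (simp add: \<tau>_def)
      have b: "0 < b"
        using \<epsilon> ln_n by (simp add: b_def)
      have a: "0 < a n"
        using n by (simp add: a_def)
      have "exp (- (\<epsilon>\<^sup>2 * real m)) \<le> exp (- (\<epsilon>\<^sup>2 * ((1 - \<epsilon>) * real n)))"
        using m(1) by (simp add: mult_left_mono)
      moreover have "real n powr (2 * \<epsilon> - 1) = exp (- b)"
        using n by (simp add: b_def powr_def algebra_simps)
      ultimately have ab: "a n \<le> exp (- b) - exp (- (\<epsilon>\<^sup>2 * real m))"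
        using elim(1) unfolding a_def by linarith
      have "real T * (ln 2)\<^sup>2 / ((1 - 2 * \<epsilon>) * real m * b) \<le> 1 - \<epsilon>"
      proof -
        have le: "1 - 3 * \<epsilon> \<le> (1 - \<epsilon>) * (1 - 2 * \<epsilon>)"
          using \<epsilon> by (simp add: algebra_simps)
        have "1 - 6 * \<epsilon> \<le> (1 - 3 * \<epsilon>) * (1 - 3 * \<epsilon>)"
          by (simp add: algebra_simps)
        also have "\<dots> \<le> ((1 - \<epsilon>) * (1 - 2 * \<epsilon>)) * ((1 - \<epsilon>) * (1 - 2 * \<epsilon>))"
          using \<epsilon> by (intro mult_mono le) auto
        finally have "(1 - 6 * \<epsilon>) * (real n * ln (real n)) \<le>
            ((1 - \<epsilon>) * (1 - 2 * \<epsilon>)) * ((1 - \<epsilon>) * (1 - 2 * \<epsilon>)) * (real n * ln (real n))"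
          using ln_n n by (intro mult_right_mono) auto
        also have "\<dots> = (1 - \<epsilon>) * ((1 - 2 * \<epsilon>) * ((1 - \<epsilon>) * real n) * b)"
          by (simp add: b_def)
        also have "\<dots> \<le> (1 - \<epsilon>) * ((1 - 2 * \<epsilon>) * real m * b)"
          using \<epsilon> b m(1) by (intro mult_left_mono mult_right_mono) auto
        finally have "(1 - 6 * \<epsilon>) * (real n * ln (real n)) \<le> (1 - \<epsilon>) * ((1 - 2 * \<epsilon>) * real m * b)" .
        moreover have "real T * (ln 2)\<^sup>2 \<le> (1 - 6 * \<epsilon>) * (real n * ln (real n))"
        proof -
          have "real T * (ln 2)\<^sup>2 \<le> c * (real n * ln (real n)) * (ln 2)\<^sup>2"
            using T by (intro mult_right_mono) auto
          then show ?thesis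
            unfolding c\<epsilon>[symmetric] by (simp only: mult_ac)
        qed
        moreover have "0 < (1 - 2 * \<epsilon>) * real m * b"
          using \<epsilon> b m_pos by simp
        ultimately show ?thesis
          by (simp add: pos_divide_le_eq)
      qed
      moreover have "real T * \<tau> n / real (Suc K) \<le> \<epsilon> / 2"
      proof -
        have "real T * \<tau> n / real (Suc K) \<le> c * (real n * ln (real n)) * \<tau> n / (real n powr (\<epsilon> / 4))"
          using T K(2) \<tau> n c(1) ln_n by (intro frac_le mult_right_mono mult_nonneg_nonneg) auto
        then show ?thesis
          using elim(2) unfolding \<tau>_def by linarith
      qed
      ultimately have \<gamma>: "\<epsilon> / 2 + real T * (ln 2)\<^sup>2 / ((1 - 2 * \<epsilon>) * real m * b) + real T * \<tau> n / real (Suc K) \<le> 1"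
        by linarith
      have "E (replicate_pmf (m + r) p) (\<lambda>zs. of_bool (\<forall>i<length zs. \<not> blocked zs i)) \<le>
         real T * exp (- (\<tau> n * real m)) +
         4 * (real K * \<tau> n) * (real M * a n + real m * exp (real m * (real K * \<tau> n)) / 2 ^ M) / (a n * (\<epsilon> / 2))\<^sup>2 +
         exp (- (real r * (a n * (\<epsilon> / 2) / 2)))"
        using sub \<epsilon> m_pos by (intro none_blocked_bound[OF _ \<tau> _ _ _ b a ab _ \<gamma>]) auto
      also have "\<dots> \<le> e n"
        unfolding e_def
      proof (intro add_mono divide_right_mono mult_mono)
        have "5 * ln (real n) \<le> 6 * (1 - \<epsilon>) * ln (real n)"
          using \<epsilon> ln_n by (intro mult_right_mono) auto
        also have "\<dots> = \<tau> n * ((1 - \<epsilon>) * real n)"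
          using n by (simp add: \<tau>_def)
        also have "\<dots> \<le> \<tau> n * real m"
          using m(1) \<tau> by (intro mult_left_mono) auto
        finally show "exp (- (\<tau> n * real m)) \<le> exp (- (5 * ln (real n)))"
          by simp
        have "real m * (real K * \<tau> n) \<le> real n * (real n powr (\<epsilon> / 4) * \<tau> n)"
          using m K \<tau> by (intro mult_mono) auto
        also have "\<dots> = 6 * real n powr (\<epsilon> / 4) * ln (real n)"
          using n by (simp add: \<tau>_def)
        finally have "exp (real m * (real K * \<tau> n)) \<le> exp (6 * real n powr (\<epsilon> / 4) * ln (real n))"
          by simp
        moreover have "exp (real n powr (\<epsilon> / 2) * ln 2) \<le> 2 ^ M"
        proof -
          have "exp (real n powr (\<epsilon> / 2) * ln 2) \<le> exp (real M * ln 2)"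
            using M(1) by simp
          then show ?thesis
            by (simp add: exp_of_nat_mult)
        qed
        ultimately show "real m * exp (real m * (real K * \<tau> n)) / 2 ^ M \<le>
            real n * exp (6 * real n powr (\<epsilon> / 4) * ln (real n)) / exp (real n powr (\<epsilon> / 2) * ln 2)"
          using m(2) by (intro frac_le mult_mono) auto
        show "exp (- (real r * (a n * (\<epsilon> / 2) / 2))) \<le> exp (- ((\<epsilon> * real n - 1) * (a n * (\<epsilon> / 2) / 2)))"
          using r(1) a \<epsilon> by (simp add: mult_right_mono)
      qed (use T K M a \<tau> c ln_n in auto)
      finally show "E (replicate_pmf n p) (\<lambda>zs. of_bool (\<forall>i<length zs. \<not> blocked zs i)) \<le> e n"
        by (simp only: mr)
    qed
  qed
  show ?thesis
    using \<open>e \<longlonglongrightarrow> 0\<close> bound by blast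
qed

subsection \<open>The star graph\<close>

lemma pmf_replicate_pmf:
  assumes "finite (set_pmf p)"
  shows "pmf (replicate_pmf (length zs) p) zs = (\<Prod>k<length zs. pmf p (zs ! k))"
proof (induction zs)
  case (Cons z zs)
  have E_pmf: "E r (\<lambda>y. of_bool (y = x)) = pmf r x" if "finite (set_pmf r)" for r :: "'z pmf" and x
    using that by (cases "x \<in> set_pmf r") (auto simp: E_finite set_pmf_iff of_bool_def if_distrib cong: if_cong)
  have "pmf (replicate_pmf (length (z # zs)) p) (z # zs) =
      E p (\<lambda>x. of_bool (x = z) * pmf (replicate_pmf (length zs) p) zs)"
    by (simp only: E_pmf[symmetric] finite_replicate_pmf assms length_Cons E_replicate_Suc list.inject of_bool_conj
        integral_mult_right_zero)
  also have "\<dots> = pmf p z * pmf (replicate_pmf (length zs) p) zs"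
    by (simp add: E_pmf assms)
  also have "\<dots> = (\<Prod>k<length (z # zs). pmf p ((z # zs) ! k))"
    by (simp add: Cons.IH prod.lessThan_Suc_shift del: prod.lessThan_Suc)
  finally show ?case .
qed simp

text \<open>The seed space is arbitrary, but only the set of transmission times before
  \<open>T\<close> matters. Its law has finite support and is thus accessible to the results
  above.\<close>

lemma pmf_of_finite_valued:
  assumes M: "prob_space M" and f: "f \<in> measurable M (count_space UNIV)"
    and R: "finite R" "\<And>s. s \<in> space M \<Longrightarrow> f s \<in> R"
  obtains p where "set_pmf p \<subseteq> R" "\<And>x. pmf p x = measure M (f -` {x} \<inter> space M)"
proof -
  interpret prob_space M by (rule M)
  let ?D = "distr M (count_space UNIV) f"
  interpret D: prob_space ?D
    by (rule prob_space_distr[OF f])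
  have "AE x in ?D. x \<in> R"
    using f R by (subst AE_distr_iff) auto
  \<comment> \<open>Almost every point being an atom is what characterises the measures that are a
    \<open>pmf\<close>.\<close>
  then have "AE x in ?D. measure ?D {x} \<noteq> 0"
    using R(1) by (subst D.AE_support_countable) (auto intro: countable_finite)
  then have p: "measure_pmf (Abs_pmf ?D) = ?D"
    by (intro Abs_pmf_inverse) (simp add: D.prob_space_axioms)
  have pmf: "pmf (Abs_pmf ?D) x = measure M (f -` {x} \<inter> space M)" for x
    by (simp add: pmf.rep_eq p measure_distr[OF f])
  have "x \<in> R" if "x \<in> set_pmf (Abs_pmf ?D)" for x
  proof (rule ccontr)
    assume "x \<notin> R"
    then have "f -` {x} \<inter> space M = {}"
      using R(2) by auto
    then show False
      using that pmf[of x] by (simp add: set_pmf_iff)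
  qed
  then show ?thesis
    using that pmf by blast
qed

text \<open>The event is a finite disjoint union of the fibres of \<open>X\<close>. Each fibre is a
  cylinder with product probability; coordinate 0, the root, is unconstrained, and position
  \<open>k\<close> of the list is leaf \<open>Suc k\<close>.\<close>

lemma prob_PiM_eq_replicate:
  fixes n :: nat
  assumes M: "prob_space M" and f: "f \<in> measurable M (count_space UNIV)"
    and R: "finite R" "\<And>s. s \<in> space M \<Longrightarrow> f s \<in> R"
    and p: "set_pmf p \<subseteq> R" "\<And>x. pmf p x = measure M (f -` {x} \<inter> space M)"
  defines "X \<equiv> \<lambda>\<omega>. map (\<lambda>k. f (\<omega> (Suc k))) [0..<n]"
  shows "{\<omega> \<in> space (PiM {0..n} (\<lambda>_. M)). Q (X \<omega>)} \<in> sets (PiM {0..n} (\<lambda>_. M))"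
    and "measure (PiM {0..n} (\<lambda>_. M)) {\<omega> \<in> space (PiM {0..n} (\<lambda>_. M)). Q (X \<omega>)} =
      E (replicate_pmf n p) (\<lambda>zs. of_bool (Q zs))"
proof -
  let ?P = "PiM {0..n} (\<lambda>_. M)"
  interpret M: prob_space M
    by (rule M)
  interpret product_prob_space "\<lambda>_. M" "{0..n}"
    by unfold_locales
  define Z where "Z = {zs. set zs \<subseteq> R \<and> length zs = n}"
  define ev where "ev zs = {\<omega> \<in> space ?P. X \<omega> = zs}" for zs
  have finZ: "finite Z"
    unfolding Z_def by (rule finite_lists_length_eq[OF R(1)])
  have ev_eq: "ev zs = {\<omega> \<in> space ?P. \<forall>i\<in>{1..n}. \<omega> i \<in> f -` {zs ! (i - 1)} \<inter> space M}"
    if "zs \<in> Z" for zs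
  proof -
    have "X \<omega> = zs \<longleftrightarrow> (\<forall>i\<in>Suc ` {..<n}. f (\<omega> i) = zs ! (i - 1))" for \<omega>
      using that by (auto simp: X_def Z_def list_eq_iff_nth_eq)
    then show ?thesis
      by (auto simp: ev_def space_PiM PiE_iff image_Suc_lessThan)
  qed
  have sets: "f -` {x} \<inter> space M \<in> sets M" for x
    using measurable_sets[OF f, of "{x}"] by simp
  have ev_sets: "ev zs \<in> sets ?P" if "zs \<in> Z" for zs
    unfolding ev_eq[OF that] using sets by measurable
  have ev_prob: "measure ?P (ev zs) = pmf (replicate_pmf n p) zs" if "zs \<in> Z" for zs
  proof -
    have "emeasure ?P (ev zs) = (\<Prod>i\<in>{1..n}. emeasure M (f -` {zs ! (i - 1)} \<inter> space M))"
      unfolding ev_eq[OF that] using sets by (intro emeasure_PiM_Collect) auto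
    also have "\<dots> = ennreal (\<Prod>i\<in>{1..n}. pmf p (zs ! (i - 1)))"
      by (simp add: p(2) M.emeasure_eq_measure prod_ennreal)
    finally have "measure ?P (ev zs) = (\<Prod>i\<in>{1..n}. pmf p (zs ! (i - 1)))"
      by (simp add: measure_def prod_nonneg)
    also have "\<dots> = (\<Prod>k<n. pmf p (zs ! k))"
      by (rule prod.reindex_bij_witness[of _ Suc "\<lambda>i. i - 1"]) auto
    also have "\<dots> = pmf (replicate_pmf n p) zs"
      using that pmf_replicate_pmf[of p zs] finite_subset[OF p(1) R(1)] by (simp add: Z_def)
    finally show ?thesis .
  qed
  have "X \<omega> \<in> Z" if "\<omega> \<in> space ?P" for \<omega>
    using that R(2) by (auto simp: X_def Z_def space_PiM PiE_iff)
  then have un: "{\<omega> \<in> space ?P. Q (X \<omega>)} = (\<Union>zs\<in>{zs\<in>Z. Q zs}. ev zs)"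
    by (auto simp: ev_def)
  show "{\<omega> \<in> space ?P. Q (X \<omega>)} \<in> sets ?P"
    unfolding un using finZ ev_sets by (intro sets.finite_UN) auto
  have "measure ?P {\<omega> \<in> space ?P. Q (X \<omega>)} = (\<Sum>zs\<in>{zs\<in>Z. Q zs}. measure ?P (ev zs))"
    unfolding un using finZ ev_sets
    by (intro P.finite_measure_finite_Union) (auto simp: disjoint_family_on_def ev_def)
  also have "\<dots> = (\<Sum>zs\<in>Z. of_bool (Q zs) * pmf (replicate_pmf n p) zs)"
    using finZ ev_prob by (simp add: Int_def sum_of_bool_mult_eq)
  also have "\<dots> = E (replicate_pmf n p) (\<lambda>zs. of_bool (Q zs))"
    using p(1) finZ by (intro integral_measure_pmf_real[symmetric]) (auto simp: Z_def set_replicate_pmf)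
  finally show "measure ?P {\<omega> \<in> space ?P. Q (X \<omega>)} = E (replicate_pmf n p) (\<lambda>zs. of_bool (Q zs))" .
qed

text \<open>Leaves never receive anything, so only the all-\<open>None\<close> history arises.
  Transmissions without the own rumor are included because they too disturb other leaves.\<close>

definition transmission_times :: "('s, 'c) protocol \<Rightarrow> nat \<Rightarrow> 's \<Rightarrow> nat set" where
  "transmission_times P T s = {t. t < T \<and> action P s (replicate t None) \<noteq> None}"

lemma not_delivered_if_blocked:
  assumes "i < n" "blocked (map (\<lambda>k. transmission_times P T (\<omega> (Suc k))) [0..<n]) i"
  shows "\<not> delivered (star n) P \<omega> T (Suc i)"
proof
  assume "delivered (star n) P \<omega> T (Suc i)"
  then have "\<exists>t<T. (\<exists>c F. action P (\<omega> (Suc i)) (replicate t None) = Some (c, True, F)) \<and>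
      (\<forall>w\<in>{1..n} - {Suc i}. action P (\<omega> w) (replicate t None) = None)"
    using assms(1) delivered_star_iff[of "Suc i" n P \<omega> T] by simp
  then obtain t c F where t: "t < T" "action P (\<omega> (Suc i)) (replicate t None) = Some (c, True, F)"
    and others: "\<And>w. w \<in> {1..n} - {Suc i} \<Longrightarrow> action P (\<omega> w) (replicate t None) = None"
    by blast
  have "t \<in> transmission_times P T (\<omega> (Suc i))"
    using t by (simp add: transmission_times_def del: not_None_eq)
  then obtain j where "j < n" "j \<noteq> i" "t \<in> transmission_times P T (\<omega> (Suc j))"
    using assms by (auto simp: blocked_def)
  then show False
    using others[of "Suc j"] by (simp add: transmission_times_def)
qed

lemma sets_action:
  assumes "is_protocol P"
  shows "{s \<in> space (seed P). Q (action P s h)} \<in> sets (seed P)"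
proof -
  have "(\<lambda>s. action P s h) \<in> measurable (seed P) (count_space UNIV)"
    using assms by (simp add: is_protocol_def)
  from measurable_sets[OF this, of "Collect Q"] show ?thesis
    by (simp add: vimage_def Int_def conj_commute)
qed

lemma runs_star: "runs (star n) P = PiM {0..n} (\<lambda>_. seed P)"
  by (simp add: runs_def star_def)

lemma prob_space_runs: "is_protocol P \<Longrightarrow> prob_space (runs N P)"
  unfolding runs_def by (intro prob_space_PiM) (simp add: is_protocol_def)

lemma sets_failure:
  assumes P: "is_protocol P"
  shows "{\<omega> \<in> space (runs (star n) P). \<exists>v\<in>{1..n}. \<not> delivered (star n) P \<omega> T v} \<in> sets (runs (star n) P)"
proof -
  have act: "{\<omega> \<in> space (runs (star n) P). Q (action P (\<omega> v) h)} \<in> sets (runs (star n) P)"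
    if "v \<in> {1..n}" for v h Q
    unfolding runs_star using that by (intro sets_Collect_single' sets_action[OF P]) auto
  have "{\<omega> \<in> space (runs (star n) P). \<not> delivered (star n) P \<omega> T v} \<in> sets (runs (star n) P)"
    if v: "v \<in> {1..n}" for v
  proof -
    have "{\<omega> \<in> space (runs (star n) P). \<not> (\<exists>t\<in>{..<T}. (\<exists>c F. action P (\<omega> v) (replicate t None) = Some (c, True, F)) \<and>
        (\<forall>w\<in>{1..n} - {v}. action P (\<omega> w) (replicate t None) = None))} \<in> sets (runs (star n) P)"
      using v by (intro sets.sets_Collect_neg sets.sets_Collect_finite_Ex sets.sets_Collect_conj
          sets.sets_Collect_finite_All act) auto
    then show ?thesis
      unfolding delivered_star_iff[OF v] by (simp only: Bex_def lessThan_iff)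
  qed
  then show ?thesis
    by (intro sets.sets_Collect_finite_Ex) auto
qed

text \<open>Only an inequality: an unblocked leaf may still fail, if it omits its own rumor whenever
  it is alone.\<close>

lemma prob_failure_ge:
  assumes P: "is_protocol P"
  obtains p :: "nat set pmf" where "\<And>A. A \<in> set_pmf p \<Longrightarrow> A \<subseteq> {..<T}"
    "1 - E (replicate_pmf n p) (\<lambda>zs. of_bool (\<forall>i<length zs. \<not> blocked zs i)) \<le>
      \<P>(\<omega> in runs (star n) P. \<exists>v\<in>{1..n}. \<not> delivered (star n) P \<omega> T v)"
proof -
  interpret runs: prob_space "runs (star n) P"
    by (rule prob_space_runs[OF P])
  have M: "prob_space (seed P)"
    using P by (simp add: is_protocol_def)
  have R: "finite (Pow {..<T})" "\<And>s. s \<in> space (seed P) \<Longrightarrow> transmission_times P T s \<in> Pow {..<T}"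
    by (auto simp: transmission_times_def)
  have f: "transmission_times P T \<in> measurable (seed P) (count_space UNIV)"
  proof -
    have "transmission_times P T -` {A} \<inter> space (seed P) \<in> sets (seed P)" if "A \<in> Pow {..<T}" for A
    proof -
      have "transmission_times P T s = A \<longleftrightarrow>
          (\<forall>t\<in>{..<T}. (action P s (replicate t None) \<noteq> None) = (t \<in> A))" for s
        using that unfolding transmission_times_def by blast
      then have "transmission_times P T -` {A} \<inter> space (seed P) =
          {s \<in> space (seed P). \<forall>t\<in>{..<T}. (action P s (replicate t None) \<noteq> None) = (t \<in> A)}"
        by blast
      also have "\<dots> \<in> sets (seed P)"
        by (intro sets.sets_Collect_finite_All sets_action[OF P]) auto
      finally show ?thesis .
    qed
    then have "transmission_times P T \<in> measurable (seed P) (count_space (Pow {..<T}))"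
      using R by (subst measurable_count_space_eq2) auto
    then show ?thesis
      by (rule measurable_compose) simp
  qed
  obtain p where p: "set_pmf p \<subseteq> Pow {..<T}" "\<And>A. pmf p A = measure (seed P) (transmission_times P T -` {A} \<inter> space (seed P))"
    using pmf_of_finite_valued[OF M f R] by blast
  let ?Q = "\<lambda>\<omega>. \<forall>i<length (map (\<lambda>k. transmission_times P T (\<omega> (Suc k))) [0..<n]). \<not> blocked (map (\<lambda>k. transmission_times P T (\<omega> (Suc k))) [0..<n]) i"
  note tr = prob_PiM_eq_replicate[OF M f R p, where n = n and Q = "\<lambda>zs. \<forall>i<length zs. \<not> blocked zs i", folded runs_star]
  have "1 - E (replicate_pmf n p) (\<lambda>zs. of_bool (\<forall>i<length zs. \<not> blocked zs i)) =
      1 - measure (runs (star n) P) {\<omega> \<in> space (runs (star n) P). ?Q \<omega>}"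
    by (simp only: tr(2))
  also have "\<dots> = measure (runs (star n) P) (space (runs (star n) P) - {\<omega> \<in> space (runs (star n) P). ?Q \<omega>})"
    using tr(1) by (simp only: runs.prob_compl)
  also have "\<dots> \<le> \<P>(\<omega> in runs (star n) P. \<exists>v\<in>{1..n}. \<not> delivered (star n) P \<omega> T v)"
  proof (rule runs.finite_measure_mono[OF _ sets_failure[OF P]], rule subsetI)
    fix \<omega> assume \<omega>: "\<omega> \<in> space (runs (star n) P) - {\<omega> \<in> space (runs (star n) P). ?Q \<omega>}"
    then obtain i where "i < n" "blocked (map (\<lambda>k. transmission_times P T (\<omega> (Suc k))) [0..<n]) i"
      by auto
    then have "Suc i \<in> {1..n}" "\<not> delivered (star n) P \<omega> T (Suc i)"
      using not_delivered_if_blocked[of i n P T \<omega>] by simp_all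
    then show "\<omega> \<in> {\<omega> \<in> space (runs (star n) P). \<exists>v\<in>{1..n}. \<not> delivered (star n) P \<omega> T v}"
      using \<omega> by blast
  qed
  finally show ?thesis
    using that p(1) by blast
qed

lemma failure_tendsto_1:
  fixes P :: "nat \<Rightarrow> ('s, 'c :: countable) protocol"
  assumes P: "\<And>n. is_protocol (P n)" and c: "c < 1 / (ln 2)\<^sup>2"
    and T: "\<forall>\<^sub>F n in sequentially. real (T n) \<le> c * (real n * ln (real n))"
  shows "(\<lambda>n. \<P>(\<omega> in runs (star n) (P n). \<exists>v\<in>{1..n}. \<not> delivered (star n) (P n) \<omega> (T n) v)) \<longlonglongrightarrow> 1"
proof -
  have ln2: "(ln 2)\<^sup>2 < (1 :: real)"
    using ln_2_less_1 by (simp add: power_less_one_iff)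
  \<comment> \<open>\<open>none_blocked_asymptotics\<close> requires a positive constant; 1 is
    admissible because \<open>ln 2 < 1\<close>.\<close>
  define c' where "c' = max c 1"
  have c': "0 < c'" "c' < 1 / (ln 2)\<^sup>2"
    using c ln2 by (auto simp: c'_def max_def divide_simps)
  obtain e where e: "e \<longlonglongrightarrow> 0" and ev: "\<forall>\<^sub>F n in sequentially. \<forall>p T.
    (\<forall>A\<in>set_pmf p. A \<subseteq> {..<T}) \<longrightarrow> real T \<le> c' * (real n * ln (real n)) \<longrightarrow>
    E (replicate_pmf n p) (\<lambda>zs. of_bool (\<forall>i<length zs. \<not> blocked zs i)) \<le> e n"
    using none_blocked_asymptotics[OF c'] by blast
  let ?P = "\<lambda>n. \<P>(\<omega> in runs (star n) (P n). \<exists>v\<in>{1..n}. \<not> delivered (star n) (P n) \<omega> (T n) v)"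
  have lower: "\<forall>\<^sub>F n in sequentially. 1 - e n \<le> ?P n"
    using ev T eventually_ge_at_top[of 1]
  proof eventually_elim
    case (elim n)
    obtain p :: "nat set pmf" where p: "\<And>A. A \<in> set_pmf p \<Longrightarrow> A \<subseteq> {..<T n}"
      "1 - E (replicate_pmf n p) (\<lambda>zs. of_bool (\<forall>i<length zs. \<not> blocked zs i)) \<le> ?P n"
      using prob_failure_ge[OF P] by blast
    have "c * (real n * ln (real n)) \<le> c' * (real n * ln (real n))"
      using elim(3) by (intro mult_right_mono) (auto simp: c'_def)
    then have "E (replicate_pmf n p) (\<lambda>zs. of_bool (\<forall>i<length zs. \<not> blocked zs i)) \<le> e n"
      using elim(2) p(1) by (intro elim(1)[rule_format, of p "T n"]) auto
    then show ?case
      using p(2) by linarith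
  qed
  have upper: "\<forall>\<^sub>F n in sequentially. ?P n \<le> 1"
    using prob_space.prob_le_1[OF prob_space_runs[OF P]] by simp
  have "(\<lambda>n. 1 - e n) \<longlonglongrightarrow> 1"
    using tendsto_diff[OF tendsto_const e, of 1] by simp
  then show ?thesis
    by (rule tendsto_sandwich[OF lower upper _ tendsto_const])
qed

section \<open>From failure to expected running time\<close>

lemma delivered_star_mono:
  assumes "v \<in> {1..n}" "delivered (star n) P \<omega> t v" "t \<le> T"
  shows "delivered (star n) P \<omega> T v"
  using assms by (auto simp: delivered_star_iff dest: less_le_trans)

text \<open>Delivery is monotone in time, so on the failure event gathering is not complete at any
  time before \<open>T\<close>, and the running time is at least \<open>T\<close> there.\<close>

lemma expected_running_time_ge:
  assumes P: "is_protocol P"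
  shows "of_nat T * ennreal (\<P>(\<omega> in runs (star n) P. \<exists>v\<in>{1..n}. \<not> delivered (star n) P \<omega> T v))
    \<le> expected_running_time (star n) P"
proof -
  interpret runs: prob_space "runs (star n) P"
    by (rule prob_space_runs[OF P])
  let ?F = "{\<omega> \<in> space (runs (star n) P). \<exists>v\<in>{1..n}. \<not> delivered (star n) P \<omega> T v}"
  have "of_nat T * ennreal (measure (runs (star n) P) ?F) = (\<integral>\<^sup>+\<omega>. of_nat T * indicator ?F \<omega> \<partial>runs (star n) P)"
    using sets_failure[OF P] by (simp add: nn_integral_cmult_indicator runs.emeasure_eq_measure)
  also have "\<dots> \<le> expected_running_time (star n) P"
    unfolding expected_running_time_def
  proof (rule nn_integral_mono)
    fix \<omega>
    show "of_nat T * indicator ?F \<omega> \<le> running_time (star n) P \<omega>"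
    proof (cases "\<omega> \<in> ?F")
      case True
      then obtain v where v: "v \<in> {1..n}" "\<not> delivered (star n) P \<omega> T v"
        by blast
      have "T \<le> t" if "\<forall>v\<in>nodes (star n). delivered (star n) P \<omega> t v" for t
        using that v delivered_star_mono[OF v(1), of P \<omega> t T] by (force simp: star_def)
      then show ?thesis
        using True unfolding running_time_def by (auto intro!: INF_greatest)
    qed simp
  qed
  finally show ?thesis .
qed

theorem theorem7:
  fixes R :: "network \<Rightarrow> ('s, 'c :: countable) protocol"
  assumes "\<And>N. rooted_tree N \<Longrightarrow> is_protocol (R N)"
  shows "(\<exists>C > 0. \<forall>\<^sub>F n in sequentially.
            ennreal (C * (real n * ln (real n))) \<le> worst_case_expected_time R n) \<and>
         (\<forall>(c :: real) (T :: nat \<Rightarrow> nat).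
            c < 1 / (ln 2)\<^sup>2 \<longrightarrow>
            (\<forall>\<^sub>F n in sequentially. real (T n) \<le> c * (real n * ln (real n))) \<longrightarrow>
            (\<lambda>n. \<P>(\<omega> in runs (star n) (R (star n)).
                    \<exists>v \<in> {1..n}. \<not> delivered (star n) (R (star n)) \<omega> (T n) v))
              \<longlonglongrightarrow> 1)"
proof (intro conjI allI impI)
  have P: "is_protocol (R (star n))" for n
    by (intro assms rooted_tree_star)
  show "(\<lambda>n. \<P>(\<omega> in runs (star n) (R (star n)).
      \<exists>v \<in> {1..n}. \<not> delivered (star n) (R (star n)) \<omega> (T n) v)) \<longlonglongrightarrow> 1"
    if "c < 1 / (ln 2)\<^sup>2" "\<forall>\<^sub>F n in sequentially. real (T n) \<le> c * (real n * ln (real n))"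
    for c and T :: "nat \<Rightarrow> nat"
    by (rule failure_tendsto_1[OF P that])
  \<comment> \<open>This is the case \<open>c = 1\<close>, which lies below the critical
    constant.\<close>
  define T where "T n = nat \<lfloor>real n * ln (real n)\<rfloor>" for n
  let ?P = "\<lambda>n. \<P>(\<omega> in runs (star n) (R (star n)).
      \<exists>v \<in> {1..n}. \<not> delivered (star n) (R (star n)) \<omega> (T n) v)"
  have "?P \<longlonglongrightarrow> 1"
  proof (rule failure_tendsto_1[OF P])
    show "1 < 1 / (ln 2 :: real)\<^sup>2"
      using ln_2_less_1 by (simp add: power_less_one_iff)
    show "\<forall>\<^sub>F n in sequentially. real (T n) \<le> 1 * (real n * ln (real n))"
      using eventually_ge_at_top[of 1] by eventually_elim (simp add: T_def of_nat_nat)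
  qed
  then have "\<forall>\<^sub>F n in sequentially. 1 / 2 < ?P n"
    by (rule order_tendstoD) simp
  \<comment> \<open>The tree with \<open>n\<close> nodes is the star with \<open>n - 1\<close>
    leaves.\<close>
  then have half: "\<forall>\<^sub>F n in sequentially. 1 / 2 < ?P (n - 1)"
    by (rule eventually_compose_filterlim) (rule filterlim_minus_const_nat_at_top)
  \<comment> \<open>One factor 1/2 is the failure probability; the other absorbs the rounding in
    \<open>T\<close> and the shift from \<open>n\<close> to \<open>n - 1\<close>.\<close>
  have asym: "\<forall>\<^sub>F n::nat in sequentially.
      1 / 4 * (real n * ln (real n)) \<le> (real (n - 1) * ln (real (n - 1)) - 1) / 2"
  proof -
    have "\<forall>\<^sub>F n::nat in sequentially.
      1 / 4 * (real n * ln (real n)) \<le> ((real n - 1) * ln (real n - 1) - 1) / 2"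
      by real_asymp
    then show ?thesis
      using eventually_ge_at_top[of 1] by eventually_elim (simp add: of_nat_diff)
  qed
  have "\<forall>\<^sub>F n in sequentially. ennreal (1 / 4 * (real n * ln (real n))) \<le> worst_case_expected_time R n"
    using half asym eventually_ge_at_top[of 1]
  proof eventually_elim
    case (elim n)
    have "real (n - 1) * ln (real (n - 1)) - 1 \<le> real (T (n - 1))"
      unfolding T_def by linarith
    then have "1 / 4 * (real n * ln (real n)) \<le> real (T (n - 1)) * (1 / 2)"
      using elim(2) by simp
    also have "\<dots> \<le> real (T (n - 1)) * ?P (n - 1)"
      using elim(1) by (intro mult_left_mono) auto
    finally have "ennreal (1 / 4 * (real n * ln (real n))) \<le> ennreal (real (T (n - 1)) * ?P (n - 1))"
      by (rule ennreal_leI)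
    also have "\<dots> = of_nat (T (n - 1)) * ennreal (?P (n - 1))"
      by (simp add: ennreal_mult ennreal_of_nat_eq_real_of_nat)
    also have "\<dots> \<le> expected_running_time (star (n - 1)) (R (star (n - 1)))"
      by (rule expected_running_time_ge[OF P])
    also have "\<dots> \<le> worst_case_expected_time R n"
      unfolding worst_case_expected_time_def using elim(3)
      by (intro SUP_upper) (simp add: rooted_tree_star, simp add: star_def)
    finally show ?case .
  qed
  then show "\<exists>C > 0. \<forall>\<^sub>F n in sequentially. ennreal (C * (real n * ln (real n))) \<le> worst_case_expected_time R n"
    by (intro exI[of _ "1 / 4"]) simp
qed

end
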